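(* There is a function $f$, computable in time polynomial in $\mathrm{size}(\Pi)$, such that for every label $w$ and every proof $\Pi$ in $\mathsf{DK_t}$ containing no application of $(cut)$ whose conclusion is the display sequent $D$: $f(\Pi)$ is a proof in $\mathsf{G3K_t}$ of $\mathfrak{L}_w(D)$, $f(\Pi)$ is a labeled polytree proof, and $\mathrm{size}(f(\Pi)) = \mathcal{O}(\mathrm{size}(\Pi)^2)$.
   Context: Formulae: $A ::= p \mid \top \mid \bot \mid \neg A \mid (A\lor A)\mid (A\land A)\mid (A\to A)\mid \mathsf{G}A\mid \mathsf{F}A\mid \mathsf{H}A\mid \mathsf{P}A$, with $p$ ranging over a countably infinite set of atoms. Display calculus. Structures: $X ::= A \mid I \mid {\ast}X \mid {\bullet}X \mid (X\circ X)$ ($A$ a formula); a display sequent is $X\vdash Y$. Length: $|A|=|I|=1$, $|{\ast}X|=|{\bullet}X|=|X|+1$, $|X\circ Y|=|X|+|Y|+1$, $|X\vdash Y|=|X|+|Y|$. Rules are schemata ($p$ any atom, $A,B$ any formulae, $X,Y,Z,W$ any structures), instantiated by uniform substitution; rules written with $\Longleftrightarrow$ may be applied in both directions. $\mathsf{DK_t}$ consists of: initial rules $p\vdash p$ $(id)$, $I\vdash\top$ $(\top_r)$, $\bot\vdash I$ $(\bot_l)$; logical rules (premise(s) / conclusion): $I\vdash Y/\top\vdash Y$; $X\vdash I/X\vdash\bot$; ${\ast}A\vdash Y/\neg A\vdash Y$; $X\vdash{\ast}A/X\vdash\neg A$; $X\circ A\vdash B/X\vdash A\to B$; $X\vdash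 A,\ B\vdash Y/A\to B\vdash{\ast}X\circ Y$; $X\vdash A\circ B/X\vdash A\lor B$; $A\vdash Y,\ B\vdash Y/A\lor B\vdash Y$; $A\circ B\vdash Y/A\land B\vdash Y$; $X\vdash A,\ X\vdash B/X\vdash A\land B$; $A\vdash Y/\mathsf GA\vdash{\bullet}Y$; ${\bullet}X\vdash A/X\vdash\mathsf GA$; $A\vdash{\ast}{\bullet}{\ast}Y/\mathsf FA\vdash Y$; $X\vdash A/{\ast}{\bullet}{\ast}X\vdash\mathsf FA$; ${\ast}{\bullet}{\ast}X\vdash A/X\vdash\mathsf HA$; $A\vdash Y/\mathsf HA\vdash{\ast}{\bullet}{\ast}Y$; $A\vdash{\bullet}Y/\mathsf PA\vdash Y$; $X\vdash A/{\bullet}X\vdash\mathsf PA$; display rules: $X\circ Y\vdash Z\Longleftrightarrow X\vdash Z\circ{\ast}Y$; $X\circ Y\vdash Z\Longleftrightarrow Y\vdash{\ast}X\circ Z$; $X\vdash Y\circ Z\Longleftrightarrow X\circ{\ast}Z\vdash Y$; $X\vdash Y\circ Z\Longleftrightarrow{\ast}Y\circ X\vdash Z$; ${\ast}X\vdash Y\Longleftrightarrow{\ast}Y\vdash X$; $X\vdash{\ast}Y\Longleftrightarrow Y\vdash{\ast}X$; ${\ast}{\ast}X\vdash Y\Longleftrightarrow X\vdash Y$; $X\vdash{\ast}{\ast}Y\Longleftrightarrow X\vdash Y$; $X\vdash{\bullet}Y\Longleftrightarrow{\bullet}X\vdash Y$; structural rules: $X\vdash Y\Longleftrightarrow I\circ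 X\vdash Y$; $X\vdash Y\Longleftrightarrow X\vdash I\circ Y$; $I\vdash Y\Longleftrightarrow{\ast}I\vdash Y$; $X\vdash I\Longleftrightarrow X\vdash{\ast}I$; $X\circ(Y\circ Z)\vdash W\Longleftrightarrow(X\circ Y)\circ Z\vdash W$; $X\vdash Y\circ(Z\circ W)\Longleftrightarrow X\vdash(Y\circ Z)\circ W$; $X\vdash Y/Z\circ X\vdash Y$; $X\vdash Y/X\vdash Y\circ Z$; $X\circ Y\vdash Z/Y\circ X\vdash Z$; $X\vdash Y\circ Z/X\vdash Z\circ Y$; $X\circ X\vdash Y/X\vdash Y$; $X\vdash Y\circ Y/X\vdash Y$; $I\vdash Y/{\bullet}I\vdash Y$; $X\vdash I/X\vdash{\bullet}I$; and $(cut)$: $X\vdash A,\ A\vdash Y/X\vdash Y$. A proof is a finite tree of sequents in which each node follows from its children by a rule instance and leaves are instances of initial rules; it proves its root. Labeled calculus. Fix a countably infinite set $\mathrm{Lab}$ of labels. A labeled sequent is $\mathcal R,\Gamma\Rightarrow\Delta$ with $\mathcal R$ a finite set of relational atoms $Rwu$ and $\Gamma,\Delta$ finite multisets of labeled formulae $w:A$ ($w,u\in\mathrm{Lab}$); its length is $|\mathcal R|+|\Gamma|+|\Delta|$. Composition: $(\mathcal R_1,\Gamma_1\Rightarrow\Delta_1)\otimes(\mathcal R_2,\Gamma_2\Rightarrow\Delta_2)=(\mathcal R_1\cup\mathcal R_2,\Gamma_1\uplus\Gamma_2\Rightarrow\Delta_1\uplus\Delta_2)$. $\mathsf{G3K_t}$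 has the rules (premise(s) / conclusion, $\mathcal R,\Gamma,\Delta$ arbitrary): initial $\mathcal R,\Gamma,w:p\Rightarrow w:p,\Delta$; $\mathcal R,\Gamma,w:\bot\Rightarrow\Delta$; $\mathcal R,\Gamma\Rightarrow w:\top,\Delta$; $\mathcal R,\Gamma\Rightarrow w:A,\Delta/\mathcal R,\Gamma,w:\neg A\Rightarrow\Delta$; $\mathcal R,\Gamma,w:A\Rightarrow\Delta/\mathcal R,\Gamma\Rightarrow w:\neg A,\Delta$; $\mathcal R,\Gamma,w:A,w:B\Rightarrow\Delta/\mathcal R,\Gamma,w:A\land B\Rightarrow\Delta$; $\mathcal R,\Gamma\Rightarrow w:A,\Delta$ and $\mathcal R,\Gamma\Rightarrow w:B,\Delta/\mathcal R,\Gamma\Rightarrow w:A\land B,\Delta$; $\mathcal R,\Gamma,w:A\Rightarrow\Delta$ and $\mathcal R,\Gamma,w:B\Rightarrow\Delta/\mathcal R,\Gamma,w:A\lor B\Rightarrow\Delta$; $\mathcal R,\Gamma\Rightarrow w:A,w:B,\Delta/\mathcal R,\Gamma\Rightarrow w:A\lor B,\Delta$; $\mathcal R,\Gamma\Rightarrow w:A,\Delta$ and $\mathcal R,\Gamma,w:B\Rightarrow\Delta/\mathcal R,\Gamma,w:A\to B\Rightarrow\Delta$; $\mathcal R,\Gamma,w:A\Rightarrow w:B,\Delta/\mathcal R,\Gamma\Rightarrow w:A\to B,\Delta$; $\mathcal R,Rwu,\Gamma,u:A\Rightarrow\Delta/\mathcal R,\Gamma,w:\mathsf FA\Rightarrow\Delta$;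 $\mathcal R,Ruw,\Gamma,u:A\Rightarrow\Delta/\mathcal R,\Gamma,w:\mathsf PA\Rightarrow\Delta$; $\mathcal R,Rwu,\Gamma\Rightarrow u:A,\Delta/\mathcal R,\Gamma\Rightarrow w:\mathsf GA,\Delta$; $\mathcal R,Ruw,\Gamma\Rightarrow u:A,\Delta/\mathcal R,\Gamma\Rightarrow w:\mathsf HA,\Delta$ (in these four, $u$ does not occur in the conclusion); $\mathcal R,Rwu,\Gamma,w:\mathsf GA,u:A\Rightarrow\Delta/\mathcal R,Rwu,\Gamma,w:\mathsf GA\Rightarrow\Delta$; $\mathcal R,Ruw,\Gamma,w:\mathsf HA,u:A\Rightarrow\Delta/\mathcal R,Ruw,\Gamma,w:\mathsf HA\Rightarrow\Delta$; $\mathcal R,Rwu,\Gamma\Rightarrow w:\mathsf FA,u:A,\Delta/\mathcal R,Rwu,\Gamma\Rightarrow w:\mathsf FA,\Delta$; $\mathcal R,Ruw,\Gamma\Rightarrow w:\mathsf PA,u:A,\Delta/\mathcal R,Ruw,\Gamma\Rightarrow w:\mathsf PA,\Delta$. Proofs are defined as for display proofs. A labeled sequent is $w$-flat if it has no relational atoms and all its labeled formulae have label $w$. Its graph has the labels as nodes and an edge $(w,u)$ for each $Rwu$. It is a labeled polytree sequent if (1) when it has no relational atoms it is $w$-flat for some $w$, (2) otherwise every label of a labeled formula occurs in a relational atom, and (3) its graph is connected and has no directed or undirected cycles. A labeled polytree proof is a proof all of whose sequents are labeled polytree sequents. Proof measures (for both calculi): the quantity $\mathrm{qty}(\Pi)$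 is the number of sequent occurrences in $\Pi$, the width $\mathrm{wdth}(\Pi)$ is the maximal length of a sequent in $\Pi$, and $\mathrm{size}(\Pi)=\mathrm{qty}(\Pi)\times\mathrm{wdth}(\Pi)$. Translation: $\mathfrak L_w(X\vdash Y)=\mathfrak L^w_1(X)\otimes\mathfrak L^w_2(Y)$ where $\mathfrak L^w_1(I)=\mathfrak L^w_2(I)=(\emptyset\Rightarrow\emptyset)$, $\mathfrak L^w_1(A)=(w:A\Rightarrow\emptyset)$, $\mathfrak L^w_2(A)=(\emptyset\Rightarrow w:A)$, $\mathfrak L^w_1({\ast}X)=\mathfrak L^w_2(X)$, $\mathfrak L^w_2({\ast}X)=\mathfrak L^w_1(X)$, $\mathfrak L^w_1({\bullet}X)=(Ruw\Rightarrow\emptyset)\otimes\mathfrak L^u_1(X)$, $\mathfrak L^w_2({\bullet}X)=(Rwv\Rightarrow\emptyset)\otimes\mathfrak L^v_2(X)$ with $u,v$ fresh labels, $\mathfrak L^w_i(X\circ Y)=\mathfrak L^w_i(X)\otimes\mathfrak L^w_i(Y)$. *)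

theory Defs
  imports "HOL-Computational_Algebra.Polynomial" "HOL-Library.Multiset" "HOL-Library.FSet"
begin

type_synonym label = nat

datatype form =
    Atom nat | Top | Bot | Neg form
  | Or form form | And form form | Imp form form
  | GG form | FF form | HH form | PP form

datatype 'a ptree = Node (concl: 'a) (subproofs: "'a ptree list")

text \<open>A calculus is the set of its rule instances, given as a relation between the list of
  premises and the conclusion. \<open>all_steps R \<Pi>\<close>: every node of \<open>\<Pi>\<close>, together with its
  children, satisfies \<open>R\<close>.\<close>

primrec all_steps :: "('a list \<Rightarrow> 'a \<Rightarrow> bool) \<Rightarrow> 'a ptree \<Rightarrow> bool" where
  "all_steps R (Node s ts) \<longleftrightarrow> R (map concl ts) s \<and> list_all (\<lambda>b. b) (map (all_steps R) ts)"

abbreviation is_proof :: "('a list \<Rightarrow> 'a \<Rightarrow> bool) \<Rightarrow> 'a ptree \<Rightarrow> bool" where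
  "is_proof calc \<Pi> \<equiv> all_steps calc \<Pi>"

primrec qty :: "'a ptree \<Rightarrow> nat" where
  "qty (Node s ts) = Suc (sum_list (map qty ts))"

definition wdth :: "('a \<Rightarrow> nat) \<Rightarrow> 'a ptree \<Rightarrow> nat" where
  "wdth len \<Pi> = Max (len ` set_ptree \<Pi>)"

definition psize :: "('a \<Rightarrow> nat) \<Rightarrow> 'a ptree \<Rightarrow> nat" where
  "psize len \<Pi> = qty \<Pi> * wdth len \<Pi>"


section \<open>The display calculus\<close>

datatype dstr =
    Fml form | Unit | Star dstr | Bullet dstr | Comp dstr dstr (infixr "\<odot>" 65)

datatype dseq = DSeq dstr dstr (infix "\<turnstile>" 50)

primrec slen :: "dstr \<Rightarrow> nat" where
  "slen (Fml A) = 1"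
| "slen Unit = 1"
| "slen (Star X) = slen X + 1"
| "slen (Bullet X) = slen X + 1"
| "slen (X \<odot> Y) = slen X + slen Y + 1"

primrec dlen :: "dseq \<Rightarrow> nat" where
  "dlen (X \<turnstile> Y) = slen X + slen Y"

abbreviation SBS :: "dstr \<Rightarrow> dstr" where
  "SBS X \<equiv> Star (Bullet (Star X))"

text \<open>The rules that may be applied in both directions.\<close>

inductive dk_double :: "dseq \<Rightarrow> dseq \<Rightarrow> bool" where
  "dk_double (X \<odot> Y \<turnstile> Z) (X \<turnstile> Z \<odot> Star Y)"
| "dk_double (X \<odot> Y \<turnstile> Z) (Y \<turnstile> Star X \<odot> Z)"
| "dk_double (X \<turnstile> Y \<odot> Z) (X \<odot> Star Z \<turnstile> Y)"
| "dk_double (X \<turnstile> Y \<odot> Z) (Star Y \<odot> X \<turnstile> Z)"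
| "dk_double (Star X \<turnstile> Y) (Star Y \<turnstile> X)"
| "dk_double (X \<turnstile> Star Y) (Y \<turnstile> Star X)"
| "dk_double (Star (Star X) \<turnstile> Y) (X \<turnstile> Y)"
| "dk_double (X \<turnstile> Star (Star Y)) (X \<turnstile> Y)"
| "dk_double (X \<turnstile> Bullet Y) (Bullet X \<turnstile> Y)"
| "dk_double (X \<turnstile> Y) (Unit \<odot> X \<turnstile> Y)"
| "dk_double (X \<turnstile> Y) (X \<turnstile> Unit \<odot> Y)"
| "dk_double (Unit \<turnstile> Y) (Star Unit \<turnstile> Y)"
| "dk_double (X \<turnstile> Unit) (X \<turnstile> Star Unit)"
| "dk_double (X \<odot> (Y \<odot> Z) \<turnstile> W) ((X \<odot> Y) \<odot> Z \<turnstile> W)"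
| "dk_double (X \<turnstile> Y \<odot> (Z \<odot> W)) (X \<turnstile> (Y \<odot> Z) \<odot> W)"

inductive dk_cutfree :: "dseq list \<Rightarrow> dseq \<Rightarrow> bool" where
  id:     "dk_cutfree [] (Fml (Atom p) \<turnstile> Fml (Atom p))"
| TopR:   "dk_cutfree [] (Unit \<turnstile> Fml Top)"
| BotL:   "dk_cutfree [] (Fml Bot \<turnstile> Unit)"
| TopL:   "dk_cutfree [Unit \<turnstile> Y] (Fml Top \<turnstile> Y)"
| BotR:   "dk_cutfree [X \<turnstile> Unit] (X \<turnstile> Fml Bot)"
| NegL:   "dk_cutfree [Star (Fml A) \<turnstile> Y] (Fml (Neg A) \<turnstile> Y)"
| NegR:   "dk_cutfree [X \<turnstile> Star (Fml A)] (X \<turnstile> Fml (Neg A))"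
| ImpR:   "dk_cutfree [X \<odot> Fml A \<turnstile> Fml B] (X \<turnstile> Fml (Imp A B))"
| ImpL:   "dk_cutfree [X \<turnstile> Fml A, Fml B \<turnstile> Y] (Fml (Imp A B) \<turnstile> Star X \<odot> Y)"
| OrR:    "dk_cutfree [X \<turnstile> Fml A \<odot> Fml B] (X \<turnstile> Fml (Or A B))"
| OrL:    "dk_cutfree [Fml A \<turnstile> Y, Fml B \<turnstile> Y] (Fml (Or A B) \<turnstile> Y)"
| AndL:   "dk_cutfree [Fml A \<odot> Fml B \<turnstile> Y] (Fml (And A B) \<turnstile> Y)"
| AndR:   "dk_cutfree [X \<turnstile> Fml A, X \<turnstile> Fml B] (X \<turnstile> Fml (And A B))"
| GL:     "dk_cutfree [Fml A \<turnstile> Y] (Fml (GG A) \<turnstile> Bullet Y)"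
| GR:     "dk_cutfree [Bullet X \<turnstile> Fml A] (X \<turnstile> Fml (GG A))"
| FL:     "dk_cutfree [Fml A \<turnstile> SBS Y] (Fml (FF A) \<turnstile> Y)"
| FR:     "dk_cutfree [X \<turnstile> Fml A] (SBS X \<turnstile> Fml (FF A))"
| HR:     "dk_cutfree [SBS X \<turnstile> Fml A] (X \<turnstile> Fml (HH A))"
| HL:     "dk_cutfree [Fml A \<turnstile> Y] (Fml (HH A) \<turnstile> SBS Y)"
| PL:     "dk_cutfree [Fml A \<turnstile> Bullet Y] (Fml (PP A) \<turnstile> Y)"
| PR:     "dk_cutfree [X \<turnstile> Fml A] (Bullet X \<turnstile> Fml (PP A))"
| down:   "dk_double S T \<Longrightarrow> dk_cutfree [S] T"
| up:     "dk_double S T \<Longrightarrow> dk_cutfree [T] S"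
| weakL:  "dk_cutfree [X \<turnstile> Y] (Z \<odot> X \<turnstile> Y)"
| weakR:  "dk_cutfree [X \<turnstile> Y] (X \<turnstile> Y \<odot> Z)"
| exchL:  "dk_cutfree [X \<odot> Y \<turnstile> Z] (Y \<odot> X \<turnstile> Z)"
| exchR:  "dk_cutfree [X \<turnstile> Y \<odot> Z] (X \<turnstile> Z \<odot> Y)"
| contrL: "dk_cutfree [X \<odot> X \<turnstile> Y] (X \<turnstile> Y)"
| contrR: "dk_cutfree [X \<turnstile> Y \<odot> Y] (X \<turnstile> Y)"
| necL:   "dk_cutfree [Unit \<turnstile> Y] (Bullet Unit \<turnstile> Y)"
| necR:   "dk_cutfree [X \<turnstile> Unit] (X \<turnstile> Bullet Unit)"

inductive dk_cut :: "dseq list \<Rightarrow> dseq \<Rightarrow> bool" where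
  "dk_cut [X \<turnstile> Fml A, Fml A \<turnstile> Y] (X \<turnstile> Y)"

definition DKt :: "dseq list \<Rightarrow> dseq \<Rightarrow> bool" where
  "DKt Ss S \<longleftrightarrow> dk_cutfree Ss S \<or> dk_cut Ss S"

definition no_cut :: "dseq ptree \<Rightarrow> bool" where
  "no_cut \<Pi> \<longleftrightarrow> all_steps (\<lambda>Ss S. \<not> dk_cut Ss S) \<Pi>"


section \<open>The labeled calculus\<close>

text \<open>The relational atom \<open>Rwu\<close> is the pair \<open>(w, u)\<close>, the labeled formula \<open>w : A\<close> the pair
  \<open>(w, A)\<close>.\<close>

datatype lseq =
  LSeq (rels: "(label \<times> label) fset") (ante: "(label \<times> form) multiset")
       (cons: "(label \<times> form) multiset")

definition llen :: "lseq \<Rightarrow> nat" where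
  "llen \<Lambda> = fcard (rels \<Lambda>) + size (ante \<Lambda>) + size (cons \<Lambda>)"

definition compose :: "lseq \<Rightarrow> lseq \<Rightarrow> lseq" (infixl "\<otimes>" 70) where
  "\<Lambda>\<^sub>1 \<otimes> \<Lambda>\<^sub>2 =
     LSeq (rels \<Lambda>\<^sub>1 |\<union>| rels \<Lambda>\<^sub>2) (ante \<Lambda>\<^sub>1 + ante \<Lambda>\<^sub>2) (cons \<Lambda>\<^sub>1 + cons \<Lambda>\<^sub>2)"

definition edges :: "lseq \<Rightarrow> (label \<times> label) set" where
  "edges \<Lambda> = fset (rels \<Lambda>)"

definition flabels :: "lseq \<Rightarrow> label set" where
  "flabels \<Lambda> = fst ` (set_mset (ante \<Lambda>) \<union> set_mset (cons \<Lambda>))"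

definition labels :: "lseq \<Rightarrow> label set" where
  "labels \<Lambda> = Field (edges \<Lambda>) \<union> flabels \<Lambda>"

inductive G3Kt :: "lseq list \<Rightarrow> lseq \<Rightarrow> bool" where
  id:   "G3Kt [] (LSeq R (add_mset (w, Atom p) \<Gamma>) (add_mset (w, Atom p) \<Delta>))"
| BotL: "G3Kt [] (LSeq R (add_mset (w, Bot) \<Gamma>) \<Delta>)"
| TopR: "G3Kt [] (LSeq R \<Gamma> (add_mset (w, Top) \<Delta>))"
| NegL: "G3Kt [LSeq R \<Gamma> (add_mset (w, A) \<Delta>)] (LSeq R (add_mset (w, Neg A) \<Gamma>) \<Delta>)"
| NegR: "G3Kt [LSeq R (add_mset (w, A) \<Gamma>) \<Delta>] (LSeq R \<Gamma> (add_mset (w, Neg A) \<Delta>))"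
| AndL: "G3Kt [LSeq R (add_mset (w, A) (add_mset (w, B) \<Gamma>)) \<Delta>]
              (LSeq R (add_mset (w, And A B) \<Gamma>) \<Delta>)"
| AndR: "G3Kt [LSeq R \<Gamma> (add_mset (w, A) \<Delta>), LSeq R \<Gamma> (add_mset (w, B) \<Delta>)]
              (LSeq R \<Gamma> (add_mset (w, And A B) \<Delta>))"
| OrL:  "G3Kt [LSeq R (add_mset (w, A) \<Gamma>) \<Delta>, LSeq R (add_mset (w, B) \<Gamma>) \<Delta>]
              (LSeq R (add_mset (w, Or A B) \<Gamma>) \<Delta>)"
| OrR:  "G3Kt [LSeq R \<Gamma> (add_mset (w, A) (add_mset (w, B) \<Delta>))]
              (LSeq R \<Gamma> (add_mset (w, Or A B) \<Delta>))"
| ImpL: "G3Kt [LSeq R \<Gamma> (add_mset (w, A) \<Delta>), LSeq R (add_mset (w, B) \<Gamma>) \<Delta>]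
              (LSeq R (add_mset (w, Imp A B) \<Gamma>) \<Delta>)"
| ImpR: "G3Kt [LSeq R (add_mset (w, A) \<Gamma>) (add_mset (w, B) \<Delta>)]
              (LSeq R \<Gamma> (add_mset (w, Imp A B) \<Delta>))"
| FL:   "u \<notin> labels (LSeq R (add_mset (w, FF A) \<Gamma>) \<Delta>) \<Longrightarrow>
         G3Kt [LSeq (finsert (w, u) R) (add_mset (u, A) \<Gamma>) \<Delta>]
              (LSeq R (add_mset (w, FF A) \<Gamma>) \<Delta>)"
| PL:   "u \<notin> labels (LSeq R (add_mset (w, PP A) \<Gamma>) \<Delta>) \<Longrightarrow>
         G3Kt [LSeq (finsert (u, w) R) (add_mset (u, A) \<Gamma>) \<Delta>]
              (LSeq R (add_mset (w, PP A) \<Gamma>) \<Delta>)"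
| GR:   "u \<notin> labels (LSeq R \<Gamma> (add_mset (w, GG A) \<Delta>)) \<Longrightarrow>
         G3Kt [LSeq (finsert (w, u) R) \<Gamma> (add_mset (u, A) \<Delta>)]
              (LSeq R \<Gamma> (add_mset (w, GG A) \<Delta>))"
| HR:   "u \<notin> labels (LSeq R \<Gamma> (add_mset (w, HH A) \<Delta>)) \<Longrightarrow>
         G3Kt [LSeq (finsert (u, w) R) \<Gamma> (add_mset (u, A) \<Delta>)]
              (LSeq R \<Gamma> (add_mset (w, HH A) \<Delta>))"
| GL:   "G3Kt [LSeq (finsert (w, u) R) (add_mset (w, GG A) (add_mset (u, A) \<Gamma>)) \<Delta>]
              (LSeq (finsert (w, u) R) (add_mset (w, GG A) \<Gamma>) \<Delta>)"
| HL:   "G3Kt [LSeq (finsert (u, w) R) (add_mset (w, HH A) (add_mset (u, A) \<Gamma>)) \<Delta>]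
              (LSeq (finsert (u, w) R) (add_mset (w, HH A) \<Gamma>) \<Delta>)"
| FR:   "G3Kt [LSeq (finsert (w, u) R) \<Gamma> (add_mset (w, FF A) (add_mset (u, A) \<Delta>))]
              (LSeq (finsert (w, u) R) \<Gamma> (add_mset (w, FF A) \<Delta>))"
| PR:   "G3Kt [LSeq (finsert (u, w) R) \<Gamma> (add_mset (w, PP A) (add_mset (u, A) \<Delta>))]
              (LSeq (finsert (u, w) R) \<Gamma> (add_mset (w, PP A) \<Delta>))"

definition flat :: "label \<Rightarrow> lseq \<Rightarrow> bool" where
  "flat w \<Lambda> \<longleftrightarrow> edges \<Lambda> = {} \<and> flabels \<Lambda> \<subseteq> {w}"

definition graph_connected :: "'v set \<Rightarrow> ('v \<times> 'v) set \<Rightarrow> bool" where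
  "graph_connected V E \<longleftrightarrow> (\<forall>x\<in>V. \<forall>y\<in>V. (x, y) \<in> (E \<union> E\<inverse>)\<^sup>*)"

text \<open>Loops and pairs of antiparallel edges are directed cycles, so undirected cycles need only
  be considered from length 3 on.\<close>

definition undirected_cycle :: "('v \<times> 'v) set \<Rightarrow> 'v list \<Rightarrow> bool" where
  "undirected_cycle E xs \<longleftrightarrow>
     3 \<le> length xs \<and> distinct xs \<and>
     (\<forall>i<length xs. (xs ! i, xs ! (Suc i mod length xs)) \<in> E \<union> E\<inverse>)"

definition polytree_seq :: "lseq \<Rightarrow> bool" where
  "polytree_seq \<Lambda> \<longleftrightarrow>
     (edges \<Lambda> = {} \<longrightarrow> (\<exists>w. flat w \<Lambda>)) \<and>
     (edges \<Lambda> \<noteq> {} \<longrightarrow> flabels \<Lambda> \<subseteq> Field (edges \<Lambda>)) \<and>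
     graph_connected (labels \<Lambda>) (edges \<Lambda>) \<and>
     acyclic (edges \<Lambda>) \<and> (\<nexists>xs. undirected_cycle (edges \<Lambda>) xs)"

definition polytree_proof :: "lseq ptree \<Rightarrow> bool" where
  "polytree_proof \<Pi> \<longleftrightarrow> is_proof G3Kt \<Pi> \<and> (\<forall>\<Lambda>\<in>set_ptree \<Pi>. polytree_seq \<Lambda>)"


section \<open>Translation of display sequents\<close>

text \<open>Fresh labels are taken in increasing order. The second argument is the next label that has
  not been used, and the second component of the result is that label after the translation.\<close>

fun tr1 :: "label \<Rightarrow> label \<Rightarrow> dstr \<Rightarrow> lseq \<times> label"
  and tr2 :: "label \<Rightarrow> label \<Rightarrow> dstr \<Rightarrow> lseq \<times> label" where
  "tr1 w n Unit = (LSeq {||} {#} {#}, n)"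
| "tr1 w n (Fml A) = (LSeq {||} {#(w, A)#} {#}, n)"
| "tr1 w n (Star X) = tr2 w n X"
| "tr1 w n (Bullet X) =
     (let (\<Lambda>, n') = tr1 n (Suc n) X in (LSeq {|(n, w)|} {#} {#} \<otimes> \<Lambda>, n'))"
| "tr1 w n (X \<odot> Y) =
     (let (\<Lambda>\<^sub>1, n') = tr1 w n X; (\<Lambda>\<^sub>2, n'') = tr1 w n' Y in (\<Lambda>\<^sub>1 \<otimes> \<Lambda>\<^sub>2, n''))"
| "tr2 w n Unit = (LSeq {||} {#} {#}, n)"
| "tr2 w n (Fml A) = (LSeq {||} {#} {#(w, A)#}, n)"
| "tr2 w n (Star X) = tr1 w n X"
| "tr2 w n (Bullet X) =
     (let (\<Lambda>, n') = tr2 n (Suc n) X in (LSeq {|(w, n)|} {#} {#} \<otimes> \<Lambda>, n'))"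
| "tr2 w n (X \<odot> Y) =
     (let (\<Lambda>\<^sub>1, n') = tr2 w n X; (\<Lambda>\<^sub>2, n'') = tr2 w n' Y in (\<Lambda>\<^sub>1 \<otimes> \<Lambda>\<^sub>2, n''))"

primrec translate :: "label \<Rightarrow> dseq \<Rightarrow> lseq" where
  "translate w (X \<turnstile> Y) =
     (let (\<Lambda>\<^sub>1, n) = tr1 w (Suc w) X; (\<Lambda>\<^sub>2, n') = tr2 w n Y in \<Lambda>\<^sub>1 \<otimes> \<Lambda>\<^sub>2)"


section \<open>Polynomial-time computability\<close>

text \<open>The machine model is first-order functional programs over binary trees, with
  call-by-value evaluation and one unit of time for each expression evaluated. A variable is an
  index into the list of values of the enclosing function's parameters and \<open>Let\<close>-bound
  variables, and a function name is an index into the program.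

  Values are shared: one step creates at most one new tree node and copies only references, and
  structurally equal trees can be kept identical, so that the equality test compares
  references. Hence, with shared values, a computation of \<open>t\<close> steps is simulated by a Turing
  machine in time polynomial in \<open>t\<close> and the size of the input.\<close>

datatype val = Nl | Pr val val

datatype expr =
    Var nat
  | Null
  | Pair expr expr
  | Hd expr
  | Tl expr
  | Equal expr expr
  | Cond expr expr expr
  | LetIn expr expr
  | Call nat "expr list"

type_synonym program = "expr list"

primrec hdv :: "val \<Rightarrow> val" where
  "hdv Nl = Nl"
| "hdv (Pr a b) = a"

primrec tlv :: "val \<Rightarrow> val" where
  "tlv Nl = Nl"
| "tlv (Pr a b) = b"

text \<open>\<open>eval P \<rho> e v t\<close>: in program \<open>P\<close> and environment \<open>\<rho>\<close>, the expression \<open>e\<close> evaluates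
  to \<open>v\<close> in \<open>t\<close> steps.\<close>

inductive eval :: "program \<Rightarrow> val list \<Rightarrow> expr \<Rightarrow> val \<Rightarrow> nat \<Rightarrow> bool"
  and evals :: "program \<Rightarrow> val list \<Rightarrow> expr list \<Rightarrow> val list \<Rightarrow> nat \<Rightarrow> bool"
  for P :: program where
  Var:   "i < length \<rho> \<Longrightarrow> eval P \<rho> (Var i) (\<rho> ! i) 1"
| Null:  "eval P \<rho> Null Nl 1"
| Pair:  "eval P \<rho> a u s \<Longrightarrow> eval P \<rho> b v t \<Longrightarrow> eval P \<rho> (Pair a b) (Pr u v) (s + t + 1)"
| Hd:    "eval P \<rho> a u s \<Longrightarrow> eval P \<rho> (Hd a) (hdv u) (s + 1)"
| Tl:    "eval P \<rho> a u s \<Longrightarrow> eval P \<rho> (Tl a) (tlv u) (s + 1)"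
| Equal: "eval P \<rho> a u s \<Longrightarrow> eval P \<rho> b v t \<Longrightarrow>
          eval P \<rho> (Equal a b) (if u = v then Pr Nl Nl else Nl) (s + t + 1)"
| CondT: "eval P \<rho> c u s \<Longrightarrow> u \<noteq> Nl \<Longrightarrow> eval P \<rho> a v t \<Longrightarrow>
          eval P \<rho> (Cond c a b) v (s + t + 1)"
| CondF: "eval P \<rho> c Nl s \<Longrightarrow> eval P \<rho> b v t \<Longrightarrow> eval P \<rho> (Cond c a b) v (s + t + 1)"
| LetIn: "eval P \<rho> a u s \<Longrightarrow> eval P (u # \<rho>) b v t \<Longrightarrow> eval P \<rho> (LetIn a b) v (s + t + 1)"
| Call:  "evals P \<rho> es us s \<Longrightarrow> i < length P \<Longrightarrow> eval P us (P ! i) v t \<Longrightarrow>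
          eval P \<rho> (Call i es) v (s + t + 1)"
| Nil:   "evals P \<rho> [] [] 0"
| Cons:  "eval P \<rho> e v s \<Longrightarrow> evals P \<rho> es vs t \<Longrightarrow> evals P \<rho> (e # es) (v # vs) (s + t)"

text \<open>The first function of a program is its main function.\<close>

definition runs :: "program \<Rightarrow> val list \<Rightarrow> val \<Rightarrow> nat \<Rightarrow> bool" where
  "runs P vs v t \<longleftrightarrow> P \<noteq> [] \<and> eval P vs (P ! 0) v t"

text \<open>\<open>f\<close> is computable on \<open>S\<close> in time polynomial in the size \<open>sz\<close> of its argument; \<open>enc\<close> gives
  the input values, and \<open>rep v y\<close> says that the value \<open>v\<close> represents the result \<open>y\<close>.\<close>

definition polytime_computable_on ::
  "'a set \<Rightarrow> ('a \<Rightarrow> nat) \<Rightarrow> ('a \<Rightarrow> val list) \<Rightarrow> (val \<Rightarrow> 'b \<Rightarrow> bool) \<Rightarrow> ('a \<Rightarrow> 'b) \<Rightarrow> bool" where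
  "polytime_computable_on S sz enc rep f \<longleftrightarrow>
     (\<exists>(P :: program) (p :: nat poly). \<forall>x\<in>S. \<exists>v t.
        runs P (enc x) v t \<and> rep v (f x) \<and> t \<le> poly p (sz x))"

primrec enc_nat :: "nat \<Rightarrow> val" where
  "enc_nat 0 = Nl"
| "enc_nat (Suc n) = Pr Nl (enc_nat n)"

primrec enc_list :: "('a \<Rightarrow> val) \<Rightarrow> 'a list \<Rightarrow> val" where
  "enc_list e [] = Nl"
| "enc_list e (x # xs) = Pr (e x) (enc_list e xs)"

primrec enc_form :: "form \<Rightarrow> val" where
  "enc_form (Atom p) = Pr (enc_nat 0) (enc_nat p)"
| "enc_form Top = Pr (enc_nat 1) Nl"
| "enc_form Bot = Pr (enc_nat 2) Nl"
| "enc_form (Neg A) = Pr (enc_nat 3) (enc_form A)"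
| "enc_form (Or A B) = Pr (enc_nat 4) (Pr (enc_form A) (enc_form B))"
| "enc_form (And A B) = Pr (enc_nat 5) (Pr (enc_form A) (enc_form B))"
| "enc_form (Imp A B) = Pr (enc_nat 6) (Pr (enc_form A) (enc_form B))"
| "enc_form (GG A) = Pr (enc_nat 7) (enc_form A)"
| "enc_form (FF A) = Pr (enc_nat 8) (enc_form A)"
| "enc_form (HH A) = Pr (enc_nat 9) (enc_form A)"
| "enc_form (PP A) = Pr (enc_nat 10) (enc_form A)"

primrec enc_dstr :: "dstr \<Rightarrow> val" where
  "enc_dstr (Fml A) = Pr (enc_nat 0) (enc_form A)"
| "enc_dstr Unit = Pr (enc_nat 1) Nl"
| "enc_dstr (Star X) = Pr (enc_nat 2) (enc_dstr X)"
| "enc_dstr (Bullet X) = Pr (enc_nat 3) (enc_dstr X)"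
| "enc_dstr (X \<odot> Y) = Pr (enc_nat 4) (Pr (enc_dstr X) (enc_dstr Y))"

primrec enc_dseq :: "dseq \<Rightarrow> val" where
  "enc_dseq (X \<turnstile> Y) = Pr (enc_dstr X) (enc_dstr Y)"

primrec enc_ptree :: "('a \<Rightarrow> val) \<Rightarrow> 'a ptree \<Rightarrow> val" where
  "enc_ptree e (Node s ts) = Pr (e s) (enc_list (\<lambda>v. v) (map (enc_ptree e) ts))"

text \<open>A labeled sequent is output as three lists, in any order; the list for the set of
  relational atoms may contain repetitions.\<close>

type_synonym lseq_lists =
  "(label \<times> label) list \<times> (label \<times> form) list \<times> (label \<times> form) list"

fun lseq_of_lists :: "lseq_lists \<Rightarrow> lseq" where
  "lseq_of_lists (rs, gs, ds) = LSeq (fset_of_list rs) (mset gs) (mset ds)"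

fun enc_pair :: "('a \<Rightarrow> val) \<Rightarrow> ('b \<Rightarrow> val) \<Rightarrow> 'a \<times> 'b \<Rightarrow> val" where
  "enc_pair e e' (x, y) = Pr (e x) (e' y)"

definition enc_lseq_lists :: "lseq_lists \<Rightarrow> val" where
  "enc_lseq_lists =
     enc_pair (enc_list (enc_pair enc_nat enc_nat))
       (enc_pair (enc_list (enc_pair enc_nat enc_form)) (enc_list (enc_pair enc_nat enc_form)))"

definition represents :: "val \<Rightarrow> lseq ptree \<Rightarrow> bool" where
  "represents v \<Pi> \<longleftrightarrow>
     (\<exists>T. v = enc_ptree enc_lseq_lists T \<and> \<Pi> = map_ptree lseq_of_lists T)"

definition cutfree_proofs :: "dseq ptree set" where
  "cutfree_proofs = {\<Pi>. is_proof DKt \<Pi> \<and> no_cut \<Pi>}"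

text \<open>The running time is measured in the size of the display proof, in which a formula counts
  as 1 however complex it is, and in which neither atoms' names nor the label \<open>w\<close> contribute.
  This is meaningful because formulae, atoms and labels are referred to and compared in one
  step in the machine model above.\<close>

definition polytime_proof_map :: "(label \<Rightarrow> dseq ptree \<Rightarrow> lseq ptree) \<Rightarrow> bool" where
  "polytime_proof_map f \<longleftrightarrow>
     polytime_computable_on (UNIV \<times> cutfree_proofs)
       (\<lambda>(w, \<Pi>). psize dlen \<Pi>)
       (\<lambda>(w, \<Pi>). [enc_nat w, enc_ptree enc_dseq \<Pi>])
       represents
       (\<lambda>(w, \<Pi>). f w \<Pi>)"

end

theory Submission
  imports Defs
begin

text \<open>The labeled proof is built from the root upwards, guided by the display proof, instead of being
  transformed rule by rule. A display sequent \<open>X \<turnstile> Y\<close> is satisfied at a label of a labeled polytree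
  sequent if its structure tree can be mapped into the polytree, the root going to that label, so
  that every formula of \<open>X \<turnstile> Y\<close> occurs at the image of its node. Display and structural rules preserve
  satisfaction from conclusion to premise and hence cost nothing: weakening forgets a part of the
  map and contraction maps two copies to the same place. A logical rule is answered by at most one
  inference of the labeled calculus. As these inferences consume their principal formulae, which
  contraction may ask for again, formulae that have been consumed remain in a history. A
  principal formula found only there has already been decomposed, and then the premise, or one of
  the two premises, is satisfied without an inference. So the labeled proof has at most as many
  sequents as the display proof, and each inference lengthens the sequent by at most one. Polytrees
  are preserved, since new labels are leaves.\<close>

section \<open>States and the traversal of a display proof\<close>

text \<open>The obstacle to a rule-by-rule translation is structural contraction: on the labeled
  side it would have to merge two subtrees, by label substitutions and contractions carried out
  throughout a proof already built. Read upwards, with maps that need not be injective, both copies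
  of the structure have the same image and nothing has to be done. The map itself is never stored:
  any label that satisfies the display sequent is as good as any other, so \<open>root\<close>
  recomputes one at each node. The history works because satisfaction and having been decomposed
  depend only on data that grows. Formulae whose rule propagates along an existing edge are never
  consumed, as \<open>G3Kt\<close> repeats them in the premise. The size bound is then arithmetic:
  for a display proof with \<open>q\<close> nodes and width \<open>d\<close>, there are at most
  \<open>q\<close> labeled sequents of length at most \<open>d + q\<close>. The time is polynomial
  because the state grows by a bounded amount per node, and because the labels satisfying a
  structure form a list whose length is bounded by the state, whatever the nesting of the
  structure.\<close>

text \<open>The flag of a signed formula is \<open>True\<close> for the antecedent. \<open>hist\<close> keeps every signed formula
  that has occurred on the branch, \<open>cur\<close> those of the current labeled sequent.\<close>

type_synonym sform = "bool \<times> label \<times> form"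

datatype state =
  State (labs: "label list") (rlist: "(label \<times> label) list") (hist: "sform list") (cur: "sform list")

definition arrow :: "bool \<Rightarrow> label \<Rightarrow> label \<Rightarrow> label \<times> label" where
  "arrow d v u = (if d then (v, u) else (u, v))"

lemma arrow_simps [simp]: "arrow True v u = (v, u)" "arrow False v u = (u, v)"
  by (simp_all add: arrow_def)

text \<open>Formulae are looked up in \<open>hist\<close>, not \<open>cur\<close>, so that consumed
  ones still count, and \<open>Unit\<close> asks only for a known label. As in \<open>tr1\<close>
  and \<open>tr2\<close>, a \<open>Bullet\<close> leads to a predecessor in the antecedent and to a
  successor in the succedent; the sign changes in \<open>SBS\<close> reverse this.\<close>

primrec sat :: "state \<Rightarrow> bool \<Rightarrow> dstr \<Rightarrow> label \<Rightarrow> bool" where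
  "sat st b (Fml A) v \<longleftrightarrow> (b, v, A) \<in> set (hist st)"
| "sat st b Unit v \<longleftrightarrow> v \<in> set (labs st)"
| "sat st b (Star X) v \<longleftrightarrow> sat st (\<not> b) X v"
| "sat st b (Bullet X) v \<longleftrightarrow> (\<exists>u. arrow b u v \<in> set (rlist st) \<and> sat st b X u)"
| "sat st b (X \<odot> Y) v \<longleftrightarrow> sat st b X v \<and> sat st b Y v"

primrec sat_seq :: "state \<Rightarrow> dseq \<Rightarrow> label \<Rightarrow> bool" where
  "sat_seq st (X \<turnstile> Y) v \<longleftrightarrow> sat st True X v \<and> sat st False Y v"

definition nbrs :: "bool \<Rightarrow> label list \<Rightarrow> (label \<times> label) list \<Rightarrow> label list" where
  "nbrs d S R = map (\<lambda>(x, y). if d then y else x) (filter (\<lambda>(x, y). (if d then x else y) \<in> set S) R)"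

definition inter :: "'a list \<Rightarrow> 'a list \<Rightarrow> 'a list" where
  "inter xs ys = filter (\<lambda>x. x \<in> set ys) xs"

text \<open>An entry is compared as a whole with a triple built from its own label, which mirrors
  the single equality test made in \<open>e_carriers\<close>.\<close>

definition carriers :: "bool \<Rightarrow> form \<Rightarrow> sform list \<Rightarrow> label list" where
  "carriers b A H = map (\<lambda>x. fst (snd x)) (filter (\<lambda>x. x = (b, fst (snd x), A)) H)"

text \<open>Evaluating \<open>sat\<close> directly takes exponential time, because every \<open>Bullet\<close> branches over all neighbours;
  \<open>sset\<close> computes the set of all satisfying labels bottom-up instead.\<close>

primrec sset :: "state \<Rightarrow> bool \<Rightarrow> dstr \<Rightarrow> label list" where
  "sset st b (Fml A) = carriers b A (hist st)"
| "sset st b Unit = labs st"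
| "sset st b (Star X) = sset st (\<not> b) X"
| "sset st b (Bullet X) = nbrs b (sset st b X) (rlist st)"
| "sset st b (X \<odot> Y) = inter (sset st b X) (sset st b Y)"

lemma set_nbrs: "set (nbrs d S R) = {v. \<exists>u\<in>set S. arrow d u v \<in> set R}"
  by (cases d) (force simp: nbrs_def)+

lemma set_carriers: "set (carriers b A H) = {v. (b, v, A) \<in> set H}"
  by (force simp: carriers_def)

lemma set_sset: "set (sset st b X) = {v. sat st b X v}"
  by (induction X arbitrary: b) (auto simp: set_nbrs set_carriers inter_def)

text \<open>Smullyan's uniform notation for signed formulae: \<open>Alpha\<close> for the
  one-premise propositional rules, \<open>Branch\<close> for those with two premises. Atoms and
  constants are filed in \<open>dec\<close> under \<open>Branch\<close> with no parts, so that
  \<open>decomposed\<close> fails for them and they never leave \<open>cur\<close>.\<close>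

datatype kind = Branch | Alpha | Modal bool bool

text \<open>The flags of \<open>Modal\<close>: whether the rule introduces a fresh label, and whether the
  modality looks forward along the relation.\<close>

primrec dec :: "bool \<Rightarrow> form \<Rightarrow> kind \<times> (bool \<times> form) list" where
  "dec b (Atom p) = (Branch, [])"
| "dec b Top = (Branch, [])"
| "dec b Bot = (Branch, [])"
| "dec b (Neg A) = (Alpha, [(\<not> b, A)])"
| "dec b (Or A B) = (if b then Branch else Alpha, [(b, A), (b, B)])"
| "dec b (And A B) = (if b then Alpha else Branch, [(b, A), (b, B)])"
| "dec b (Imp A B) = (if b then Branch else Alpha, [(\<not> b, A), (b, B)])"
| "dec b (GG A) = (Modal (\<not> b) True, [(b, A)])"
| "dec b (FF A) = (Modal b True, [(b, A)])"
| "dec b (HH A) = (Modal (\<not> b) False, [(b, A)])"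
| "dec b (PP A) = (Modal b False, [(b, A)])"

definition place :: "label \<Rightarrow> (bool \<times> form) list \<Rightarrow> sform list" where
  "place u ps = map (\<lambda>(b, A). (b, u, A)) ps"

primrec side :: "bool \<Rightarrow> dseq \<Rightarrow> dstr" where
  "side b (X \<turnstile> Y) = (if b then X else Y)"

text \<open>The arguments are the conclusion and the first premise. When both sides of the conclusion
  are formulae, the left one is principal if the right one survives in the premise. For a
  structural rule the answer is arbitrary but harmless.\<close>

definition princ :: "dseq \<Rightarrow> dseq \<Rightarrow> (bool \<times> form) option" where
  "princ s s1 =
     (case side False s of
        Fml B \<Rightarrow>
          (case side True s of
             Fml A \<Rightarrow>
               (if side False s1 = Fml B \<or> side False s1 = Bullet (Fml B) \<or> side False s1 = SBS (Fml B)
                then Some (True, A) else Some (False, B))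
           | _ \<Rightarrow> Some (False, B))
      | _ \<Rightarrow> (case side True s of Fml A \<Rightarrow> Some (True, A) | _ \<Rightarrow> None))"

text \<open>The default \<open>0\<close> is the one the machine gives: \<open>hdv Nl\<close> is
  \<open>Nl\<close>, the code of \<open>0\<close>. Hence taking the head computes
  \<open>first\<close> on the empty list too, see \<open>hdv_labs\<close>.\<close>

primrec first :: "nat list \<Rightarrow> nat" where
  "first [] = 0"
| "first (x # xs) = x"

definition root :: "state \<Rightarrow> dseq \<Rightarrow> label" where
  "root st s = first (inter (sset st True (side True s)) (sset st False (side False s)))"

section \<open>Updates of the state and the traversal\<close>

definition replace :: "state \<Rightarrow> sform \<Rightarrow> (bool \<times> form) list \<Rightarrow> state" where
  "replace st c ps =
     (let xs = place (fst (snd c)) ps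
      in State (labs st) (rlist st) (xs @ hist st) (xs @ remove1 c (cur st)))"

text \<open>The largest label is kept at the front of \<open>labs\<close>, so its successor is fresh
  without a search.\<close>

definition grow :: "state \<Rightarrow> bool \<Rightarrow> sform \<Rightarrow> (bool \<times> form) list \<Rightarrow> state" where
  "grow st d c ps =
     (let u = Suc (first (labs st)); xs = place u ps
      in State (u # labs st) (arrow d (fst (snd c)) u # rlist st)
           (xs @ hist st) (xs @ remove1 c (cur st)))"

text \<open>Nothing leaves \<open>cur\<close>, because the rules \<open>GL\<close>,
  \<open>HL\<close>, \<open>FR\<close> and \<open>PR\<close> of \<open>G3Kt\<close> keep their
  principal formula. The same update enters the formulae of the end sequent in
  \<open>load\<close>.\<close>

definition copy :: "state \<Rightarrow> label \<Rightarrow> (bool \<times> form) list \<Rightarrow> state" where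
  "copy st u ps =
     State (labs st) (rlist st) (place u ps @ hist st) (place u ps @ cur st)"

text \<open>In the display rules \<open>GL\<close>, \<open>HL\<close>, \<open>FR\<close> and
  \<open>PR\<close> the context of the premise sits below a bullet in the conclusion, that is, at a
  neighbour of the root label. The part of the principal formula has to be copied to a neighbour
  where that context is satisfied.\<close>

definition targets :: "state \<Rightarrow> bool \<Rightarrow> bool \<Rightarrow> label \<Rightarrow> dseq \<Rightarrow> label list" where
  "targets st d b v s1 = inter (nbrs d [v] (rlist st)) (sset st (\<not> b) (side (\<not> b) s1))"

text \<open>\<open>None\<close> means that no inference is made: the formula was consumed earlier,
  or the candidate does not fit a one-premise rule with the given premise. The traversal then goes
  on with the same state.\<close>

definition ustep :: "state \<Rightarrow> sform \<Rightarrow> dseq \<Rightarrow> state option" where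
  "ustep st c s1 =
     (case c of (b, v, A) \<Rightarrow>
      (if c \<in> set (cur st) then
         (case dec b A of
            (Branch, ps) \<Rightarrow> None
          | (Alpha, ps) \<Rightarrow> Some (replace st c ps)
          | (Modal f d, ps) \<Rightarrow>
              (if f then Some (grow st d c ps)
               else (case targets st d b v s1 of
                       [] \<Rightarrow> None
                     | u # us \<Rightarrow> Some (copy st u ps))))
       else None))"

definition flt :: "bool \<Rightarrow> sform list \<Rightarrow> (label \<times> form) list" where
  "flt b G = map snd (filter (\<lambda>x. fst x = b) G)"

definition out :: "state \<Rightarrow> lseq_lists" where
  "out st = (rlist st, flt True (cur st), flt False (cur st))"

definition cand :: "state \<Rightarrow> dseq \<Rightarrow> dseq \<Rightarrow> sform option" where
  "cand st s s1 = map_option (\<lambda>(b, A). (b, root st s, A)) (princ s s1)"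

text \<open>If the principal formula of a binary node was consumed earlier, only the subproof whose
  part is in the history is followed and the other one is dropped. The bare leaves returned at
  binary nodes make the function total; a cut-free proof started in a satisfying state never reaches
  them.\<close>

fun build :: "state \<Rightarrow> dseq ptree \<Rightarrow> lseq_lists ptree" where
  "build st (Node s []) = Node (out st) []"
| "build st (Node s [t]) =
     (case Option.bind (cand st s (concl t)) (\<lambda>c. ustep st c (concl t)) of
        None \<Rightarrow> build st t
      | Some st' \<Rightarrow> Node (out st) [build st' t])"
| "build st (Node s (t1 # t2 # ts)) =
     (case cand st s (concl t1) of
        None \<Rightarrow> Node (out st) []
      | Some (b, v, A) \<Rightarrow>
         (case snd (dec b A) of
            p1 # p2 # ps \<Rightarrow>
              (if (b, v, A) \<in> set (cur st) then
                 Node (out st) [build (replace st (b, v, A) [p1]) t1, build (replace st (b, v, A) [p2]) t2]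
               else if (fst p1, v, snd p1) \<in> set (hist st) then build st t1 else build st t2)
          | _ \<Rightarrow> Node (out st) []))"

section \<open>Trees\<close>

text \<open>The vertex set is a separate argument because a sequent with neither relational atoms
  nor formulae does not show the label at which it lives.\<close>

definition is_tree :: "'v set \<Rightarrow> ('v \<times> 'v) set \<Rightarrow> bool" where
  "is_tree V E \<longleftrightarrow> E \<subseteq> V \<times> V \<and> graph_connected V E \<and> acyclic E \<and> (\<nexists>xs. undirected_cycle E xs)"

lemma is_tree_singleton: "is_tree {v} {}"
  by (auto simp: is_tree_def graph_connected_def acyclic_def undirected_cycle_def
      intro!: exI[of _ "0 :: nat"])

text \<open>If \<open>u\<close> were on the cycle, its predecessor and its successor there would
  both be its only neighbour \<open>v\<close>. They occupy different positions since the length is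
  at least 3, which contradicts distinctness.\<close>

lemma undirected_cycle_add_leaf:
  assumes cyc: "undirected_cycle E' xs"
    and leaf: "\<And>x. (x, u) \<in> E' \<union> E'\<inverse> \<Longrightarrow> x = v"
    and E': "\<And>x y. (x, y) \<in> E' \<Longrightarrow> x \<noteq> u \<Longrightarrow> y \<noteq> u \<Longrightarrow> (x, y) \<in> E"
  shows "undirected_cycle E xs"
proof -
  let ?n = "length xs"
  have n: "3 \<le> ?n" and d: "distinct xs"
    and e: "\<And>i. i < ?n \<Longrightarrow> (xs ! i, xs ! (Suc i mod ?n)) \<in> E' \<union> E'\<inverse>"
    using cyc by (auto simp: undirected_cycle_def)
  have nu: "u \<notin> set xs"
  proof
    assume "u \<in> set xs"
    then obtain i where i: "i < ?n" "xs ! i = u" by (auto simp: in_set_conv_nth)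
    \<comment> \<open>The cyclic predecessor of position \<open>i\<close>.\<close>
    define j where "j = (if i = 0 then ?n - 1 else i - 1)"
    have j: "j < ?n" "Suc j mod ?n = i" using i n by (auto simp: j_def)
    let ?k = "Suc i mod ?n"
    have k: "?k < ?n" using n by (intro mod_less_divisor) linarith
    have "xs ! j = v" using e[OF j(1)] i j leaf by auto
    moreover have "xs ! ?k = v" using e[OF i(1)] i leaf by auto
    ultimately have "j = ?k" using nth_eq_iff_index_eq[OF d j(1) k] by simp
    moreover have "?k = (if Suc i = ?n then 0 else Suc i)" using i by auto
    ultimately show False using i n by (auto simp: j_def split: if_splits)
  qed
  have "(xs ! i, xs ! (Suc i mod ?n)) \<in> E \<union> E\<inverse>" if "i < ?n" for i
  proof -
    have "xs ! i \<in> set xs" "xs ! (Suc i mod ?n) \<in> set xs"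
      using that n by (auto intro!: nth_mem mod_less_divisor)
    then show ?thesis using e[OF that] E' nu by blast
  qed
  then show ?thesis using n d by (auto simp: undirected_cycle_def)
qed

lemma is_tree_add_leaf:
  assumes T: "is_tree V E" and v: "v \<in> V" and u: "u \<notin> V" and e: "e = (v, u) \<or> e = (u, v)"
  shows "is_tree (insert u V) (insert e E)"
proof -
  let ?E = "insert e E"
  let ?S = "?E \<union> ?E\<inverse>"
  have EV: "E \<subseteq> V \<times> V" and con: "graph_connected V E" and ac: "acyclic E"
    and cy: "\<nexists>xs. undirected_cycle E xs"
    using T by (auto simp: is_tree_def)
  have uE: "(x, u) \<notin> E" "(u, x) \<notin> E" for x using EV u by auto
  have uv: "u \<noteq> v" using u v by auto
  have old: "(x, y) \<in> ?S\<^sup>*" if "x \<in> V" "y \<in> V" for x y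
  proof -
    have "(x, y) \<in> (E \<union> E\<inverse>)\<^sup>*" using con that by (auto simp: graph_connected_def)
    then show ?thesis by (rule rtrancl_mono[THEN subsetD, rotated]) auto
  qed
  have new: "(u, v) \<in> ?S" "(v, u) \<in> ?S" using e by auto
  have "(x, y) \<in> ?S\<^sup>*" if "x \<in> insert u V" "y \<in> insert u V" for x y
  proof -
    have "(z, v) \<in> ?S\<^sup>*" "(v, z) \<in> ?S\<^sup>*" if "z \<in> insert u V" for z
      using that old[of z v] old[of v z] v new by blast+
    then show ?thesis using that by (meson rtrancl_trans)
  qed
  then have "graph_connected (insert u V) ?E"
    unfolding graph_connected_def by blast
  moreover have "acyclic ?E"
  proof -
    \<comment> \<open>\<open>u\<close> is isolated in \<open>E\<close>, so a path that starts or
      ends there has length zero.\<close>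
    have "(u, v) \<notin> E\<^sup>*" "(v, u) \<notin> E\<^sup>*"
      using uE uv by (auto elim: rtranclE converse_rtranclE)
    then show ?thesis using e ac by (auto simp: acyclic_insert)
  qed
  moreover have "\<nexists>xs. undirected_cycle ?E xs"
  proof
    assume "\<exists>xs. undirected_cycle ?E xs"
    then obtain xs where "undirected_cycle ?E xs" ..
    then have "undirected_cycle E xs"
      by (rule undirected_cycle_add_leaf[where u = u and v = v]) (use e uE uv in auto)
    with cy show False by blast
  qed
  ultimately show ?thesis using EV v e by (auto simp: is_tree_def)
qed

text \<open>Connectedness does the work: without edges it forces \<open>V\<close> to be a singleton,
  which gives flatness, and with an edge present it gives every vertex an incident edge.\<close>

lemma polytree_seq_if_tree:
  assumes T: "is_tree V (edges \<Lambda>)" and fl: "flabels \<Lambda> \<subseteq> V" and ne: "V \<noteq> {}"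
  shows "polytree_seq \<Lambda>"
proof -
  let ?E = "edges \<Lambda>"
  have EV: "?E \<subseteq> V \<times> V" and con: "graph_connected V ?E" and ac: "acyclic ?E"
    and cy: "\<nexists>xs. undirected_cycle ?E xs"
    using T by (auto simp: is_tree_def)
  obtain v where v: "v \<in> V" using ne by blast
  have "flat v \<Lambda>" if E: "?E = {}"
  proof -
    have "x = v" if "x \<in> V" for x
    proof -
      have "(x, v) \<in> (?E \<union> ?E\<inverse>)\<^sup>*" using con that v unfolding graph_connected_def by blast
      then show ?thesis using E by simp
    qed
    then show ?thesis using fl E by (auto simp: flat_def)
  qed
  moreover have "flabels \<Lambda> \<subseteq> Field ?E" if ne: "?E \<noteq> {}"
  proof
    fix x assume "x \<in> flabels \<Lambda>"
    then have x: "x \<in> V" using fl by auto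
    obtain a b where ab: "(a, b) \<in> ?E" using ne by auto
    then have a: "a \<in> V" using EV by auto
    have "(x, a) \<in> (?E \<union> ?E\<inverse>)\<^sup>*" using con x a unfolding graph_connected_def by blast
    then show "x \<in> Field ?E"
    proof (cases rule: converse_rtranclE)
      case base then show ?thesis using ab by (auto intro: FieldI1)
    next
      case (step y) then show ?thesis by (auto intro: FieldI1 FieldI2)
    qed
  qed
  moreover have "labels \<Lambda> \<subseteq> V" using EV fl by (auto simp: labels_def Field_def)
  then have "graph_connected (labels \<Lambda>) ?E" using con by (auto simp: graph_connected_def)
  ultimately show ?thesis using ac cy by (auto simp: polytree_seq_def)
qed

section \<open>The invariant\<close>

text \<open>Hintikka-style saturation conditions, read in the history. One part suffices for
  \<open>Branch\<close> because the current branch went through one of the two premises. A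
  \<open>Modal\<close> formula without a fresh label never counts as decomposed: its rule keeps it,
  and it may be wanted again at another neighbour.\<close>

definition decomposed :: "state \<Rightarrow> sform \<Rightarrow> bool" where
  "decomposed st c =
     (case c of (b, v, A) \<Rightarrow>
        (case dec b A of
           (Branch, ps) \<Rightarrow> \<exists>x\<in>set (place v ps). x \<in> set (hist st)
         | (Alpha, ps) \<Rightarrow> set (place v ps) \<subseteq> set (hist st)
         | (Modal f d, ps) \<Rightarrow>
             f \<and> (\<exists>u. arrow d v u \<in> set (rlist st) \<and> set (place u ps) \<subseteq> set (hist st))))"

definition invar :: "state \<Rightarrow> bool" where
  "invar st \<longleftrightarrow>
     labs st \<noteq> [] \<and> (\<forall>v\<in>set (labs st). v \<le> first (labs st)) \<and>
     is_tree (set (labs st)) (set (rlist st)) \<and>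
     (\<forall>x\<in>set (hist st). fst (snd x) \<in> set (labs st)) \<and>
     set (cur st) \<subseteq> set (hist st) \<and>
     (\<forall>c\<in>set (hist st). c \<in> set (cur st) \<or> decomposed st c)"

definition seq :: "state \<Rightarrow> lseq" where
  "seq st = lseq_of_lists (out st)"

text \<open>\<open>cur\<close> is left out on purpose: it can lose formulae, whereas
  \<open>sat\<close> and \<open>decomposed\<close> read only the components that grow and are
  therefore monotone.\<close>

definition extends :: "state \<Rightarrow> state \<Rightarrow> bool" where
  "extends st st' \<longleftrightarrow> set (labs st) \<subseteq> set (labs st') \<and> set (rlist st) \<subseteq> set (rlist st') \<and>
     set (hist st) \<subseteq> set (hist st')"

lemma extends_refl [simp]: "extends st st"
  by (simp add: extends_def)

lemma extends_steps:
  "extends st (replace st c ps)" "extends st (grow st d c ps)" "extends st (copy st u ps)"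
  by (auto simp: extends_def replace_def grow_def copy_def Let_def)

lemma sat_mono: "sat st b X v \<Longrightarrow> extends st st' \<Longrightarrow> sat st' b X v"
  by (induction X arbitrary: b v) (auto simp: extends_def)

lemma decomposed_mono:
  assumes "decomposed st c" and ext: "extends st st'"
  shows "decomposed st' c"
proof -
  obtain b v A where c: "c = (b, v, A)" by (cases c)
  obtain k ps where d: "dec b A = (k, ps)" by (cases "dec b A")
  have R: "set (rlist st) \<subseteq> set (rlist st')" and H: "set (hist st) \<subseteq> set (hist st')"
    using ext by (auto simp: extends_def)
  show ?thesis
  proof (cases k)
    case (Modal f e)
    then have "f" "\<exists>u. arrow e v u \<in> set (rlist st) \<and> set (place u ps) \<subseteq> set (hist st)"
      using assms c d by (auto simp: decomposed_def)
    then have "\<exists>u. arrow e v u \<in> set (rlist st') \<and> set (place u ps) \<subseteq> set (hist st')"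
      using R H by blast
    then show ?thesis using c d Modal \<open>f\<close> by (simp add: decomposed_def)
  qed (use assms c d R H in \<open>auto simp: decomposed_def\<close>)
qed

lemma hist_labs: "invar st \<Longrightarrow> (b, v, A) \<in> set (hist st) \<Longrightarrow> v \<in> set (labs st)"
  by (fastforce simp: invar_def)

lemma rlist_labs: "invar st \<Longrightarrow> arrow b u v \<in> set (rlist st) \<Longrightarrow> u \<in> set (labs st) \<and> v \<in> set (labs st)"
  by (cases b) (auto simp: invar_def is_tree_def)

text \<open>This makes the rules that add a \<open>Unit\<close> free, as the label asked for is
  known from the rest of the sequent.\<close>

lemma sat_labs: "invar st \<Longrightarrow> sat st b X v \<Longrightarrow> v \<in> set (labs st)"
  by (induction X arbitrary: b v) (auto dest: hist_labs rlist_labs)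

lemma fst_snd_place [simp]: "x \<in> set (place u ps) \<Longrightarrow> fst (snd x) = u"
  by (auto simp: place_def)

lemma edges_seq [simp]: "edges (seq st) = set (rlist st)"
  by (simp add: edges_def seq_def out_def fset_of_list.rep_eq)

lemma flabels_seq: "flabels (seq st) = (\<lambda>x. fst (snd x)) ` set (cur st)"
  by (force simp: flabels_def seq_def out_def flt_def image_iff)

lemma labels_seq: "invar st \<Longrightarrow> labels (seq st) \<subseteq> set (labs st)"
  by (force simp: labels_def flabels_seq invar_def is_tree_def Field_def)

lemma polytree_seq_seq: "invar st \<Longrightarrow> polytree_seq (seq st)"
  by (rule polytree_seq_if_tree[where V = "set (labs st)"])
    (force simp: invar_def flabels_seq)+

text \<open>The common pattern of the steps: \<open>xs\<close> enters both \<open>hist\<close> and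
  \<open>cur\<close>, and \<open>c\<close> is the only formula that may leave \<open>cur\<close>.
  For all other formulae the last clause of the invariant persists by
  \<open>decomposed_mono\<close>.\<close>

lemma invar_cases:
  assumes inv: "invar st" and ext: "extends st st'"
    and labs: "labs st' \<noteq> []" "\<forall>v\<in>set (labs st'). v \<le> first (labs st')"
    and tree: "is_tree (set (labs st')) (set (rlist st'))"
    and hist: "set (hist st') = set xs \<union> set (hist st)"
    and xs: "\<forall>x\<in>set xs. fst (snd x) \<in> set (labs st')"
    and cur: "set (cur st') \<subseteq> set xs \<union> set (cur st)" "set xs \<subseteq> set (cur st')"
      "set (cur st) \<subseteq> insert c (set (cur st'))"
    and c: "c \<in> set (cur st') \<or> decomposed st' c"
  shows "invar st'"
proof -
  have "e \<in> set (cur st') \<or> decomposed st' e" if "e \<in> set (hist st')" for e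
  proof (cases "e \<in> set xs")
    case False
    with that hist inv have "e \<in> set (cur st) \<or> decomposed st e" by (auto simp: invar_def)
    then show ?thesis using cur c decomposed_mono[OF _ ext] by blast
  qed (use cur in auto)
  moreover have "\<forall>x\<in>set (hist st). fst (snd x) \<in> set (labs st')"
    using inv ext by (auto simp: invar_def extends_def)
  moreover have "set (cur st') \<subseteq> set (hist st')" using cur hist inv by (auto simp: invar_def)
  ultimately show ?thesis using labs tree xs hist by (auto simp: invar_def)
qed

lemma subset_insert_remove1: "set xs \<subseteq> insert x (set (remove1 x xs))"
  by (induction xs) auto

lemma cur_labs: "invar st \<Longrightarrow> (b, v, A) \<in> set (cur st) \<Longrightarrow> v \<in> set (labs st)"
  by (rule hist_labs) (auto simp: invar_def)

lemma invar_replace_aux: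
  assumes inv: "invar st" and c: "(b, v, A) \<in> set (cur st)"
    and d: "decomposed (replace st (b, v, A) ps) (b, v, A)"
  shows "invar (replace st (b, v, A) ps)"
  by (rule invar_cases[OF inv extends_steps(1), where xs = "place v ps" and c = "(b, v, A)"])
    (use inv cur_labs[OF inv c] d set_remove1_subset[of "(b, v, A)" "cur st"]
      subset_insert_remove1[of "cur st" "(b, v, A)"] in \<open>auto simp: invar_def replace_def Let_def\<close>)

lemma invar_replace:
  assumes "invar st" "(b, v, A) \<in> set (cur st)" "dec b A = (Alpha, ps)"
  shows "invar (replace st (b, v, A) ps)"
  by (rule invar_replace_aux[OF assms(1,2)])
    (use assms(3) in \<open>auto simp: decomposed_def replace_def Let_def\<close>)

lemma invar_replace_branch:
  assumes "invar st" "(b, v, A) \<in> set (cur st)" "dec b A = (Branch, ps)" "p \<in> set ps"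
  shows "invar (replace st (b, v, A) [p])"
  by (rule invar_replace_aux[OF assms(1,2)])
    (use assms(3,4) in \<open>auto simp: decomposed_def replace_def place_def Let_def\<close>)

lemma invar_grow:
  assumes inv: "invar st" and c: "(b, v, A) \<in> set (cur st)" and dec: "dec b A = (Modal True d, ps)"
  shows "invar (grow st d (b, v, A) ps)"
proof -
  let ?u = "Suc (first (labs st))" and ?st = "grow st d (b, v, A) ps"
  have m: "\<forall>v\<in>set (labs st). v \<le> first (labs st)"
    and T: "is_tree (set (labs st)) (set (rlist st))"
    using inv by (auto simp: invar_def)
  have "?u \<notin> set (labs st)" using m by force
  then have tree: "is_tree (insert ?u (set (labs st))) (insert (arrow d v ?u) (set (rlist st)))"
    by (intro is_tree_add_leaf[OF T cur_labs[OF inv c]]) (auto simp: arrow_def)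
  have "decomposed ?st (b, v, A)"
    using dec by (auto simp: decomposed_def grow_def Let_def)
  then show ?thesis
    by (intro invar_cases[OF inv extends_steps(2), where xs = "place ?u ps" and c = "(b, v, A)"])
      (use tree m set_remove1_subset[of "(b, v, A)" "cur st"]
        subset_insert_remove1[of "cur st" "(b, v, A)"]
        in \<open>auto simp: grow_def Let_def le_Suc_eq\<close>)
qed

lemma invar_copy:
  assumes inv: "invar st" and u: "u \<in> set (labs st)"
  shows "invar (copy st u ps)"
\<comment> \<open>\<open>invar_cases\<close> has to be given some \<open>c\<close>. Nothing leaves
  \<open>cur\<close> here, so any member of the history serves, if there is one.\<close>
proof (cases "hist st")
  case Nil
  then show ?thesis using assms by (auto simp: invar_def copy_def)
next
  case (Cons c _)
  then have "c \<in> set (cur st) \<or> decomposed st c" using inv by (auto simp: invar_def)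
  then have "c \<in> set (cur (copy st u ps)) \<or> decomposed (copy st u ps) c"
    using decomposed_mono[of st c "copy st u ps"] extends_steps(3) by (auto simp: copy_def)
  then show ?thesis
    by (intro invar_cases[OF inv extends_steps(3), where xs = "place u ps" and c = c])
      (use inv u in \<open>auto simp: invar_def copy_def\<close>)
qed

section \<open>Soundness of the steps\<close>

definition lpart :: "bool \<Rightarrow> sform multiset \<Rightarrow> (label \<times> form) multiset" where
  "lpart b M = image_mset snd (filter_mset (\<lambda>x. fst x = b) M)"

lemma lpart_add [simp]:
  "lpart b (add_mset (b', x) M) = (if b' = b then add_mset x (lpart b M) else lpart b M)"
  by (simp add: lpart_def)

text \<open>With both sides in one signed multiset, a single lemma for each kind of formula covers
  left and right rules.\<close>

definition signed_seq :: "(label \<times> label) fset \<Rightarrow> sform multiset \<Rightarrow> lseq" where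
  "signed_seq R M = LSeq R (lpart True M) (lpart False M)"

lemma seq_eq: "seq st = signed_seq (fset_of_list (rlist st)) (mset (cur st))"
  by (simp add: seq_def out_def signed_seq_def flt_def lpart_def)

lemma G3Kt_alpha:
  "dec b A = (Alpha, ps) \<Longrightarrow>
     G3Kt [signed_seq R (mset (place v ps) + M)] (signed_seq R (add_mset (b, v, A) M))"
  by (cases A) (auto simp: signed_seq_def place_def split: if_splits intro: G3Kt.intros)

lemma G3Kt_branch:
  "dec b A = (Branch, [p, q]) \<Longrightarrow>
     G3Kt [signed_seq R (mset (place v [p]) + M), signed_seq R (mset (place v [q]) + M)]
       (signed_seq R (add_mset (b, v, A) M))"
  by (cases A) (auto simp: signed_seq_def place_def split: if_splits intro: G3Kt.intros)

lemma G3Kt_fresh: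
  "dec b A = (Modal True d, ps) \<Longrightarrow> u \<notin> labels (signed_seq R (add_mset (b, v, A) M)) \<Longrightarrow>
     G3Kt [signed_seq (finsert (arrow d v u) R) (mset (place u ps) + M)]
       (signed_seq R (add_mset (b, v, A) M))"
  by (cases A) (auto simp: signed_seq_def place_def intro: G3Kt.intros)

lemma G3Kt_copy:
  assumes "dec b A = (Modal False d, ps)" "arrow d v u |\<in>| R"
  shows "G3Kt [signed_seq R (mset (place u ps) + add_mset (b, v, A) M)]
    (signed_seq R (add_mset (b, v, A) M))"
proof -
  have "R = finsert (arrow d v u) R" using assms(2) by (simp add: finsert_absorb)
  then obtain R' where R: "R = finsert (arrow d v u) R'" by (rule that)
  show ?thesis
    using assms(1) unfolding R
    by (cases A) (auto simp: signed_seq_def place_def intro: G3Kt.GL G3Kt.HL G3Kt.FR G3Kt.PR)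
qed

lemma G3Kt_id:
  assumes "(True, v, Atom p) \<in># M" "(False, v, Atom p) \<in># M"
  shows "G3Kt [] (signed_seq R M)"
proof -
  obtain N where N: "M = add_mset (True, v, Atom p) N"
    using assms(1) by (blast dest: multi_member_split)
  moreover obtain N' where "N = add_mset (False, v, Atom p) N'"
    using assms(2) unfolding N by (auto dest: multi_member_split)
  ultimately show ?thesis by (simp add: signed_seq_def G3Kt.id)
qed

lemma G3Kt_Bot: "(True, v, Bot) \<in># M \<Longrightarrow> G3Kt [] (signed_seq R M)"
  by (auto dest!: multi_member_split simp: signed_seq_def G3Kt.BotL)

lemma G3Kt_Top: "(False, v, Top) \<in># M \<Longrightarrow> G3Kt [] (signed_seq R M)"
  by (auto dest!: multi_member_split simp: signed_seq_def G3Kt.TopR)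

lemma mset_cur: "c \<in> set (cur st) \<Longrightarrow> mset (cur st) = add_mset c (mset (remove1 c (cur st)))"
  by simp

lemma G3Kt_replace:
  assumes "(b, v, A) \<in> set (cur st)" "dec b A = (Alpha, ps)"
  shows "G3Kt [seq (replace st (b, v, A) ps)] (seq st)"
  unfolding seq_eq mset_cur[OF assms(1)]
  using G3Kt_alpha[OF assms(2)] by (simp add: replace_def Let_def)

lemma G3Kt_replace_branch:
  assumes "(b, v, A) \<in> set (cur st)" "dec b A = (Branch, [p, q])"
  shows "G3Kt [seq (replace st (b, v, A) [p]), seq (replace st (b, v, A) [q])] (seq st)"
  unfolding seq_eq mset_cur[OF assms(1)]
  using G3Kt_branch[OF assms(2)] by (simp add: replace_def Let_def)

lemma G3Kt_grow:
  assumes inv: "invar st" and c: "(b, v, A) \<in> set (cur st)" and d: "dec b A = (Modal True d, ps)"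
  shows "G3Kt [seq (grow st d (b, v, A) ps)] (seq st)"
proof -
  let ?u = "Suc (first (labs st))" and ?M = "mset (remove1 (b, v, A) (cur st))"
  have "?u \<notin> set (labs st)" using inv by (force simp: invar_def)
  then have "?u \<notin> labels (seq st)" using labels_seq[OF inv] by blast
  then have "?u \<notin> labels (signed_seq (fset_of_list (rlist st)) (add_mset (b, v, A) ?M))"
    unfolding seq_eq mset_cur[OF c] .
  from G3Kt_fresh[OF d this] show ?thesis
    unfolding seq_eq mset_cur[OF c] by (simp add: grow_def Let_def)
qed

lemma G3Kt_copy_state:
  assumes "(b, v, A) \<in> set (cur st)" "dec b A = (Modal False d, ps)" "arrow d v u \<in> set (rlist st)"
  shows "G3Kt [seq (copy st u ps)] (seq st)"
proof -
  have "arrow d v u |\<in>| fset_of_list (rlist st)"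
    using assms(3) by (simp add: fset_of_list_elem)
  from G3Kt_copy[OF assms(2) this, where M = "mset (remove1 (b, v, A) (cur st))"] assms(1)
  show ?thesis by (simp add: seq_eq copy_def)
qed

lemma set_targets:
  "set (targets st d b v s1) = {u. arrow d v u \<in> set (rlist st) \<and> sat st (\<not> b) (side (\<not> b) s1) u}"
  by (auto simp: targets_def inter_def set_nbrs set_sset)

section \<open>Correctness of one-premise steps and growth of the sequents\<close>

lemma ustep_Some:
  assumes st': "ustep st (b, v, A) s1 = Some st'"
  obtains (alpha) ps where "(b, v, A) \<in> set (cur st)" "dec b A = (Alpha, ps)"
      "st' = replace st (b, v, A) ps"
  | (fresh) d ps where "(b, v, A) \<in> set (cur st)" "dec b A = (Modal True d, ps)"
      "st' = grow st d (b, v, A) ps"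
  | (copy) d ps u where "(b, v, A) \<in> set (cur st)" "dec b A = (Modal False d, ps)"
      "st' = copy st u ps" "u \<in> set (targets st d b v s1)"
  using assms
  by (cases "dec b A") (force simp: ustep_def split: if_splits kind.splits list.splits)

lemma length_dec: "length (snd (dec b A)) \<le> 2"
  by (cases A) auto

lemma length_dec_Modal: "fst (dec b A) = Modal f d \<Longrightarrow> length (snd (dec b A)) = 1"
  by (cases A) (auto split: if_splits)

text \<open>An upper bound for \<open>llen\<close> that is additive in list lengths; repeated edges
  would be counted again.\<close>

definition weight :: "state \<Rightarrow> nat" where
  "weight st = length (rlist st) + length (cur st)"

text \<open>The display rule does not enter: \<open>ustep\<close> acts only on a formula of
  \<open>cur\<close>, so even an inference provoked by a structural rule is correct. The weight
  rises by at most one since \<open>Alpha\<close> trades one formula for at most two, a fresh label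
  costs an edge while one formula replaces another, and copying adds one formula.\<close>

lemma ustep_sound:
  assumes inv: "invar st" and st': "ustep st c s1 = Some st'"
  shows "invar st'" "extends st st'" "G3Kt [seq st'] (seq st)" "weight st' \<le> Suc (weight st)"
proof -
  obtain b v A where c: "c = (b, v, A)" by (cases c)
  have "invar st' \<and> extends st st' \<and> G3Kt [seq st'] (seq st) \<and> weight st' \<le> Suc (weight st)"
    using st'[unfolded c]
  proof (cases rule: ustep_Some)
    case (alpha ps)
    obtain n where n: "length (cur st) = Suc n" using alpha(1) by (cases "cur st") auto
    have "weight st' \<le> Suc (weight st)"
      using alpha length_dec[of b A] n
      by (auto simp: weight_def replace_def Let_def place_def length_remove1)
    with alpha inv show ?thesis by (simp add: invar_replace extends_steps G3Kt_replace)
  next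
    case (fresh d ps)
    obtain n where n: "length (cur st) = Suc n" using fresh(1) by (cases "cur st") auto
    have "weight st' \<le> Suc (weight st)"
      using fresh length_dec_Modal[of b A True d] n
      by (auto simp: weight_def grow_def Let_def place_def length_remove1)
    with fresh inv show ?thesis by (simp add: invar_grow extends_steps G3Kt_grow)
  next
    case (copy d ps u)
    have u: "arrow d v u \<in> set (rlist st)" using copy by (simp add: set_targets)
    have "weight st' \<le> Suc (weight st)"
      using copy length_dec_Modal[of b A False d] by (auto simp: weight_def copy_def place_def)
    with copy inv u rlist_labs[OF inv u] show ?thesis
      by (simp add: invar_copy extends_steps G3Kt_copy_state)
  qed
  then show "invar st'" "extends st st'" "G3Kt [seq st'] (seq st)" "weight st' \<le> Suc (weight st)"
    by auto
qed

section \<open>Progress along the display proof\<close>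

text \<open>The label found need not be the witness \<open>v\<close>. That it satisfies the sequent
  too is what allows the map into the polytree to be forgotten between nodes.\<close>

lemma sat_seq_root:
  assumes "sat_seq st s v"
  shows "sat_seq st s (root st s)"
proof -
  obtain X Y where s: "s = (X \<turnstile> Y)" by (cases s)
  let ?I = "inter (sset st True X) (sset st False Y)"
  have set: "set ?I = {v. sat_seq st s v}" by (auto simp: inter_def set_sset s)
  then have "?I \<noteq> []" using assms by (metis empty_iff empty_set mem_Collect_eq)
  then have "first ?I \<in> set ?I" by (cases ?I) simp_all
  then show ?thesis unfolding set by (simp add: root_def s)
qed

lemma sat_seq_mono: "sat_seq st s v \<Longrightarrow> extends st st' \<Longrightarrow> sat_seq st' s v"
  by (cases s) (auto intro: sat_mono)

text \<open>Both sequents unfold to the same conditions, up to a \<open>Unit\<close> that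
  \<open>sat_labs\<close> settles. In the rule moving a \<open>Bullet\<close> across the turnstile
  the root travels along an edge, hence the two separate existential quantifiers.\<close>

lemma sat_seq_double:
  assumes "dk_double S T" and inv: "invar st"
  shows "(\<exists>v. sat_seq st S v) \<longleftrightarrow> (\<exists>v. sat_seq st T v)"
  using assms(1) by cases (auto dest: sat_labs[OF inv])

definition advance :: "state \<Rightarrow> dseq \<Rightarrow> dseq \<Rightarrow> state" where
  "advance st s s1 =
     (case Option.bind (cand st s s1) (\<lambda>c. ustep st c s1) of None \<Rightarrow> st | Some st' \<Rightarrow> st')"

lemma advance_sound:
  assumes "invar st"
  shows "invar (advance st s s1)" "extends st (advance st s s1)"
  using assms ustep_sound(1,2) by (auto simp: advance_def split: bind_splits option.splits)

context
  fixes st s s1 b v A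
  assumes inv: "invar st" and cand: "cand st s s1 = Some (b, v, A)" and hist: "(b, v, A) \<in> set (hist st)"
begin

lemma cur_or_decomposed: "(b, v, A) \<in> set (cur st) \<or> decomposed st (b, v, A)"
  using inv hist by (auto simp: invar_def)

text \<open>Either the inference is made now, or it was made earlier and the invariant supplies the
  parts.\<close>

lemma advance_alpha:
  assumes "dec b A = (Alpha, ps)"
  shows "set (place v ps) \<subseteq> set (hist (advance st s s1))"
  using cur_or_decomposed assms cand
  by (auto simp: advance_def ustep_def replace_def Let_def decomposed_def)

lemma advance_fresh:
  assumes "dec b A = (Modal True d, ps)"
  shows "\<exists>u. arrow d v u \<in> set (rlist (advance st s s1)) \<and>
    set (place u ps) \<subseteq> set (hist (advance st s s1))"
proof (cases "(b, v, A) \<in> set (cur st)")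
  case True
  then show ?thesis using assms cand by (auto simp: advance_def ustep_def grow_def Let_def)
next
  case False
  then show ?thesis using cur_or_decomposed assms cand
    by (auto simp: advance_def ustep_def decomposed_def)
qed

text \<open>The principal formula must be current, as \<open>decomposed\<close> never holds for this
  kind. The given \<open>u\<close> only shows that there are targets; the label used is the first of
  them, which satisfies the context as well.\<close>

lemma advance_copy:
  assumes d: "dec b A = (Modal False d, ps)"
    and u: "arrow d v u \<in> set (rlist st)" "sat st (\<not> b) (side (\<not> b) s1) u"
  shows "\<exists>u. arrow d v u \<in> set (rlist (advance st s s1)) \<and>
    sat (advance st s s1) (\<not> b) (side (\<not> b) s1) u \<and>
    set (place u ps) \<subseteq> set (hist (advance st s s1))"
proof -
  have c: "(b, v, A) \<in> set (cur st)"
    using cur_or_decomposed d by (auto simp: decomposed_def)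
  have "u \<in> set (targets st d b v s1)" using u by (simp add: set_targets)
  then obtain u' us where ts: "targets st d b v s1 = u' # us"
    by (cases "targets st d b v s1") auto
  then have u': "arrow d v u' \<in> set (rlist st)" "sat st (\<not> b) (side (\<not> b) s1) u'"
    using set_targets[of st d b v s1] by auto
  have adv: "advance st s s1 = copy st u' ps"
    using cand c d ts by (simp add: advance_def ustep_def)
  show ?thesis
    using u' sat_mono[OF u'(2) extends_steps(3)] unfolding adv by (auto simp: copy_def)
qed

end

text \<open>The context survives by monotonicity, and the parts of the principal formula are in the
  history, whether or not an inference is made. The premise is satisfied at the root label for
  propositional rules, at a target for \<open>GL\<close>, \<open>HL\<close>, \<open>FR\<close>,
  \<open>PR\<close>, and at the label once introduced for the formula for \<open>GR\<close>,
  \<open>HR\<close>, \<open>FL\<close>, \<open>PL\<close>.\<close>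

lemma sat_seq_advance:
  assumes rule: "dk_cutfree [s1] s" and inv: "invar st" and sat: "sat_seq st s v0"
  shows "\<exists>v. sat_seq (advance st s s1) s1 v"
proof -
  let ?v = "root st s" and ?st = "advance st s s1"
  have v: "sat_seq st s ?v" using sat by (rule sat_seq_root)
  note ext = advance_sound(2)[OF inv, of s s1]
  have mono: "sat st b X u \<Longrightarrow> sat ?st b X u" for b X u by (rule sat_mono[OF _ ext])
  have labs: "sat st b X u \<Longrightarrow> u \<in> set (labs ?st)" for b X u
    using sat_labs[OF inv] ext by (auto simp: extends_def)
  \<comment> \<open>Satisfaction in the old state is enough, since \<open>advance\<close> can only
    extend it, even if it acts on a spurious candidate.\<close>
  have structural: "\<exists>v. sat_seq ?st s1 v" if "\<exists>v. sat_seq st s1 v"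
    using that sat_seq_mono[OF _ ext] by blast
  have alpha: "set (place ?v ps) \<subseteq> set (hist ?st)"
    if "princ s s1 = Some (b, A)" "(b, ?v, A) \<in> set (hist st)" "dec b A = (Alpha, ps)" for b A ps
    by (rule advance_alpha[OF inv _ that(2,3)]) (simp add: cand_def that(1))
  have fresh: "\<exists>u. arrow d ?v u \<in> set (rlist ?st) \<and> set (place u ps) \<subseteq> set (hist ?st)"
    if "princ s s1 = Some (b, A)" "(b, ?v, A) \<in> set (hist st)" "dec b A = (Modal True d, ps)" for b A d ps
    by (rule advance_fresh[OF inv _ that(2,3)]) (simp add: cand_def that(1))
  have copy: "\<exists>u. arrow d ?v u \<in> set (rlist ?st) \<and> sat ?st (\<not> b) (side (\<not> b) s1) u \<and>
      set (place u ps) \<subseteq> set (hist ?st)"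
    if "princ s s1 = Some (b, A)" "(b, ?v, A) \<in> set (hist st)" "dec b A = (Modal False d, ps)"
      "arrow d ?v u \<in> set (rlist st)" "sat st (\<not> b) (side (\<not> b) s1) u" for b A d ps u
    by (rule advance_copy[OF inv _ that(2,3) that(4,5)]) (simp add: cand_def that(1))
  from rule show ?thesis
  proof cases
    case (TopL Y)
    with v have "sat_seq st s1 ?v" by (auto dest: hist_labs[OF inv])
    then show ?thesis by (blast intro: structural)
  next
    case (BotR X)
    with v have "sat_seq st s1 ?v" by (auto dest: hist_labs[OF inv])
    then show ?thesis by (blast intro: structural)
  next
    case (NegL A Y)
    then have "princ s s1 = Some (True, Neg A)" by (auto simp: princ_def split: dstr.splits)
    from alpha[OF this] v NegL mono[of False Y ?v] show ?thesis by (auto simp: place_def)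
  next
    case (NegR X A)
    \<comment> \<open>\<open>X\<close> may be a formula as well. The right side of the premise is
      \<open>Star (Fml A)\<close> here, and in the other right rules a \<open>Comp\<close> or a
      proper subformula, so it never has one of the forms by which \<open>princ\<close> recognises a
      surviving right side.\<close>
    then have "princ s s1 = Some (False, Neg A)" by (auto simp: princ_def split: dstr.splits)
    from alpha[OF this] v NegR mono[of True X ?v] show ?thesis by (auto simp: place_def)
  next
    case (ImpR X A B)
    then have "princ s s1 = Some (False, Imp A B)" by (auto simp: princ_def split: dstr.splits)
    from alpha[OF this] v ImpR mono[of True X ?v] show ?thesis by (auto simp: place_def)
  next
    case (OrR X A B)
    then have "princ s s1 = Some (False, Or A B)" by (auto simp: princ_def split: dstr.splits)
    from alpha[OF this] v OrR mono[of True X ?v] show ?thesis by (auto simp: place_def)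
  next
    case (AndL A B Y)
    then have "princ s s1 = Some (True, And A B)" by (auto simp: princ_def split: dstr.splits)
    from alpha[OF this] v AndL mono[of False Y ?v] show ?thesis by (auto simp: place_def)
  next
    case (GL A Y)
    then have p: "princ s s1 = Some (True, GG A)" by (auto simp: princ_def split: dstr.splits)
    obtain u where "arrow True ?v u \<in> set (rlist st)" "sat st False Y u" using v GL by auto
    then obtain u' where "sat ?st False Y u'" "(True, u', A) \<in> set (hist ?st)"
      using copy[OF p, of True "[(True, A)]" u] v GL by (auto simp: place_def)
    then have "sat_seq ?st s1 u'" unfolding GL by simp
    then show ?thesis ..
  next
    case (HL A Y)
    then have p: "princ s s1 = Some (True, HH A)" by (auto simp: princ_def split: dstr.splits)
    obtain u where "arrow False ?v u \<in> set (rlist st)" "sat st False Y u" using v HL by auto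
    then obtain u' where "sat ?st False Y u'" "(True, u', A) \<in> set (hist ?st)"
      using copy[OF p, of False "[(True, A)]" u] v HL by (auto simp: place_def)
    then have "sat_seq ?st s1 u'" unfolding HL by simp
    then show ?thesis ..
  next
    case (FR X A)
    then have p: "princ s s1 = Some (False, FF A)" by (auto simp: princ_def split: dstr.splits)
    obtain u where "arrow True ?v u \<in> set (rlist st)" "sat st True X u" using v FR by auto
    then obtain u' where "sat ?st True X u'" "(False, u', A) \<in> set (hist ?st)"
      using copy[OF p, of True "[(False, A)]" u] v FR by (auto simp: place_def)
    then have "sat_seq ?st s1 u'" unfolding FR by simp
    then show ?thesis ..
  next
    case (PR X A)
    then have p: "princ s s1 = Some (False, PP A)" by (auto simp: princ_def split: dstr.splits)
    obtain u where "arrow False ?v u \<in> set (rlist st)" "sat st True X u" using v PR by auto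
    then obtain u' where "sat ?st True X u'" "(False, u', A) \<in> set (hist ?st)"
      using copy[OF p, of False "[(False, A)]" u] v PR by (auto simp: place_def)
    then have "sat_seq ?st s1 u'" unfolding PR by simp
    then show ?thesis ..
  next
    case (GR X A)
    then have p: "princ s s1 = Some (False, GG A)" by (auto simp: princ_def split: dstr.splits)
    obtain u where "arrow True ?v u \<in> set (rlist ?st)" "(False, u, A) \<in> set (hist ?st)"
      using fresh[OF p, of True "[(False, A)]"] v GR by (auto simp: place_def)
    moreover have "sat ?st True X ?v" using v GR mono[of True X ?v] by auto
    ultimately have "sat_seq ?st s1 u" unfolding GR by auto
    then show ?thesis ..
  next
    case (HR X A)
    then have p: "princ s s1 = Some (False, HH A)" by (auto simp: princ_def split: dstr.splits)
    obtain u where "arrow False ?v u \<in> set (rlist ?st)" "(False, u, A) \<in> set (hist ?st)"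
      using fresh[OF p, of False "[(False, A)]"] v HR by (auto simp: place_def)
    moreover have "sat ?st True X ?v" using v HR mono[of True X ?v] by auto
    ultimately have "sat_seq ?st s1 u" unfolding HR by auto
    then show ?thesis ..
  next
    case (FL A Y)
    then have p: "princ s s1 = Some (True, FF A)" by (auto simp: princ_def split: dstr.splits)
    obtain u where "arrow True ?v u \<in> set (rlist ?st)" "(True, u, A) \<in> set (hist ?st)"
      using fresh[OF p, of True "[(True, A)]"] v FL by (auto simp: place_def)
    moreover have "sat ?st False Y ?v" using v FL mono[of False Y ?v] by auto
    ultimately have "sat_seq ?st s1 u" unfolding FL by auto
    then show ?thesis ..
  next
    case (PL A Y)
    then have p: "princ s s1 = Some (True, PP A)" by (auto simp: princ_def split: dstr.splits)
    obtain u where "arrow False ?v u \<in> set (rlist ?st)" "(True, u, A) \<in> set (hist ?st)"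
      using fresh[OF p, of False "[(True, A)]"] v PL by (auto simp: place_def)
    moreover have "sat ?st False Y ?v" using v PL mono[of False Y ?v] by auto
    ultimately have "sat_seq ?st s1 u" unfolding PL by auto
    then show ?thesis ..
  next
    case down
    then show ?thesis using sat_seq_double[OF down inv] sat by (blast intro: structural)
  next
    case up
    then show ?thesis using sat_seq_double[OF up inv] sat by (blast intro: structural)
  \<comment> \<open>Left over are weakening, exchange, contraction, \<open>necL\<close> and
    \<open>necR\<close>, where every demand of the premise follows from those of the
    conclusion.\<close>
  qed ((rule structural, use sat in \<open>auto dest: sat_labs[OF inv]\<close>)[1])+
qed

text \<open>Atoms and constants have no parts, so they cannot be decomposed and the invariant finds
  them in \<open>cur\<close>, where the initial rules need them.\<close>

lemma G3Kt_leaf_state: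
  assumes rule: "dk_cutfree [] s" and inv: "invar st" and sat: "sat_seq st s v"
  shows "G3Kt [] (seq st)"
proof -
  have inert: "c \<in> set (cur st)" if "c \<in> set (hist st)" "dec (fst c) (snd (snd c)) = (Branch, [])" for c
  proof -
    have "c \<in> set (cur st) \<or> decomposed st c" using inv that(1) by (auto simp: invar_def)
    then show ?thesis using that(2) by (cases c) (auto simp: decomposed_def place_def)
  qed
  from rule show ?thesis
  proof cases
    case (id p)
    then show ?thesis
      using sat inert[of "(True, v, Atom p)"] inert[of "(False, v, Atom p)"]
      by (auto simp: seq_eq intro!: G3Kt_id)
  next
    case TopR
    then show ?thesis
      using sat inert[of "(False, v, Top)"] by (auto simp: seq_eq intro!: G3Kt_Top)
  next
    case BotL
    then show ?thesis
      using sat inert[of "(True, v, Bot)"] by (auto simp: seq_eq intro!: G3Kt_Bot)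
  qed
qed

text \<open>Each premise is satisfied in any extension that contains its own part. This serves both
  the inference, which adds the part, and the shortcut, which finds it in the history.\<close>

lemma branch_rule:
  assumes rule: "dk_cutfree [s1, s2] s" and sat: "sat_seq st s v0"
  obtains b A p q where
    "cand st s s1 = Some (b, root st s, A)" "dec b A = (Branch, [p, q])"
    "(b, root st s, A) \<in> set (hist st)"
    "\<And>st'. extends st st' \<Longrightarrow> (fst p, root st s, snd p) \<in> set (hist st') \<Longrightarrow> sat_seq st' s1 (root st s)"
    "\<And>st'. extends st st' \<Longrightarrow> (fst q, root st s, snd q) \<in> set (hist st') \<Longrightarrow> sat_seq st' s2 (root st s)"
proof -
  have v: "sat_seq st s (root st s)" using sat by (rule sat_seq_root)
  from rule show thesis
  proof cases
    case (ImpL X A B Y)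
    with v show thesis
      by (intro that[of True "Imp A B" "(False, A)" "(True, B)"])
        (auto simp: cand_def princ_def intro: sat_mono)
  next
    case (OrL A Y B)
    with v show thesis
      by (intro that[of True "Or A B" "(True, A)" "(True, B)"])
        (auto simp: cand_def princ_def intro: sat_mono split: dstr.splits)
  next
    case (AndR X A B)
    with v show thesis
      by (intro that[of False "And A B" "(False, A)" "(False, B)"])
        (auto simp: cand_def princ_def intro: sat_mono split: dstr.splits)
  qed
qed

lemma dk_cutfree_premises:
  "dk_cutfree ss s \<Longrightarrow> ss = [] \<or> (\<exists>s1. ss = [s1]) \<or> (\<exists>s1 s2. ss = [s1, s2])"
  by (cases rule: dk_cutfree.cases) auto

section \<open>The labeled proof\<close>

lemma all_steps_Node [simp]:
  "all_steps R (Node s ts) \<longleftrightarrow> R (map concl ts) s \<and> (\<forall>t\<in>set ts. all_steps R t)"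
  by (simp add: list_all_iff)

declare all_steps.simps [simp del]

lemma cutfree_proofD:
  "is_proof DKt \<Pi> \<and> no_cut \<Pi> \<Longrightarrow> all_steps dk_cutfree \<Pi>"
  unfolding no_cut_def by (induction \<Pi>) (auto simp: DKt_def)

abbreviation lproof :: "state \<Rightarrow> dseq ptree \<Rightarrow> lseq ptree" where
  "lproof st \<Pi> \<equiv> map_ptree lseq_of_lists (build st \<Pi>)"

lemma qty_pos [simp]: "0 < qty \<Pi>"
  by (cases \<Pi>) simp

text \<open>One number bounds the count of sequents and also the excess length over the root state,
  because each inference adds at most one to the weight.\<close>

definition adequate :: "state \<Rightarrow> nat \<Rightarrow> lseq ptree \<Rightarrow> bool" where
  "adequate st n \<Pi> \<longleftrightarrow>
     all_steps G3Kt \<Pi> \<and> concl \<Pi> = seq st \<and> qty \<Pi> \<le> n \<and>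
     (\<forall>\<Lambda>\<in>set_ptree \<Pi>. polytree_seq \<Lambda> \<and> llen \<Lambda> \<le> weight st + n)"

lemma llen_seq: "llen (seq st) \<le> weight st"
proof -
  have "size (filter_mset fst (mset (cur st))) + size (filter_mset (\<lambda>x. \<not> fst x) (mset (cur st))) =
      length (cur st)"
    by (metis multiset_partition size_mset size_union)
  moreover have "fcard (fset_of_list (rlist st)) \<le> length (rlist st)"
    by (simp add: fcard.rep_eq fset_of_list.rep_eq card_length)
  ultimately show ?thesis
    by (simp add: llen_def weight_def seq_def out_def flt_def)
qed

lemma adequate_mono: "adequate st m \<Pi> \<Longrightarrow> m \<le> n \<Longrightarrow> adequate st n \<Pi>"
  by (force simp: adequate_def)

lemma adequate_Node:
  assumes inv: "invar st" and step: "G3Kt (map seq sts) (seq st)"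
    and subs: "list_all2 (\<lambda>(st', n) \<Pi>. adequate st' n \<Pi> \<and> weight st' \<le> Suc (weight st)) (zip sts ns) ts"
    and len: "length sts = length ns"
  shows "adequate st (Suc (sum_list ns)) (Node (seq st) ts)"
proof -
  have lt: "length ts = length ns" using list_all2_lengthD[OF subs] len by simp
  have sub: "adequate (sts ! i) (ns ! i) (ts ! i)" "weight (sts ! i) \<le> Suc (weight st)"
    if "i < length ns" for i
    using list_all2_nthD[OF subs, of i] that len by auto
  have "map concl ts = map seq sts"
    using sub lt len by (auto intro!: nth_equalityI simp: adequate_def)
  moreover have "all_steps G3Kt t" if "t \<in> set ts" for t
    using that sub(1) lt by (auto simp: in_set_conv_nth adequate_def)
  moreover have "sum_list (map qty ts) \<le> sum_list ns"
    using sub(1) lt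
    by (auto simp: sum_list_sum_nth adequate_def intro!: sum_mono)
  moreover have "polytree_seq \<Lambda> \<and> llen \<Lambda> \<le> weight st + Suc (sum_list ns)"
    if t: "t \<in> set ts" and L: "\<Lambda> \<in> set_ptree t" for t \<Lambda>
  proof -
    obtain i where i: "i < length ns" "t = ts ! i" using t lt by (auto simp: in_set_conv_nth)
    have "polytree_seq \<Lambda>" "llen \<Lambda> \<le> weight (sts ! i) + ns ! i"
      using sub(1)[OF i(1)] L i(2) by (auto simp: adequate_def)
    moreover have "ns ! i \<le> sum_list ns" using i(1) by (intro member_le_sum_list) auto
    ultimately show ?thesis using sub(2)[OF i(1)] by linarith
  qed
  ultimately show ?thesis
    using step polytree_seq_seq[OF inv] llen_seq[of st] by (auto simp: adequate_def)
qed

lemma weight_replace: "c \<in> set (cur st) \<Longrightarrow> weight (replace st c [p]) = weight st"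
  by (cases "cur st") (auto simp: weight_def replace_def Let_def place_def length_remove1
      dest: length_pos_if_in_set)

text \<open>The label has to be arbitrary in the induction, as a premise may be satisfied elsewhere
  than its conclusion.\<close>

lemma adequate_build:
  "all_steps dk_cutfree \<Pi> \<Longrightarrow> invar st \<Longrightarrow> sat_seq st (concl \<Pi>) v \<Longrightarrow>
     adequate st (qty \<Pi>) (lproof st \<Pi>)"
proof (induction st \<Pi> arbitrary: v rule: build.induct)
  case (1 st s)
  then show ?case
    using adequate_Node[of st "[]" "[]" "[]"] G3Kt_leaf_state[of s st v]
    by (simp add: seq_def)
next
  case (2 st s t)
  have rule: "dk_cutfree [concl t] s" and t: "all_steps dk_cutfree t" using 2(3) by auto
  have sat: "sat_seq st s v" using 2(5) by simp
  obtain u where u: "sat_seq (advance st s (concl t)) (concl t) u"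
    using sat_seq_advance[OF rule 2(4) sat] by blast
  show ?case
  proof (cases "Option.bind (cand st s (concl t)) (\<lambda>c. ustep st c (concl t))")
    case None
    with u have "adequate st (qty t) (lproof st t)"
      using 2(1)[OF None t 2(4)] by (simp add: advance_def)
    then show ?thesis using None by (simp add: adequate_mono)
  next
    case (Some st')
    then obtain c where c: "ustep st c (concl t) = Some st'" by (auto split: bind_splits)
    note s = ustep_sound[OF 2(4) c]
    have "adequate st' (qty t) (lproof st' t)"
      using 2(2)[OF Some t s(1)] u Some by (simp add: advance_def)
    then show ?thesis
      using adequate_Node[OF 2(4), of "[st']" "[qty t]" "[lproof st' t]"] s Some
      by (simp add: seq_def)
  qed
next
  case (3 st s t1 t2 ts)
  from 3(5) have "dk_cutfree (map concl (t1 # t2 # ts)) s" by simp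
  moreover from this have ts: "ts = []" by (auto dest: dk_cutfree_premises)
  ultimately have rule: "dk_cutfree [concl t1, concl t2] s" by simp
  have t: "all_steps dk_cutfree t1" "all_steps dk_cutfree t2" using 3(5) by auto
  have sat: "sat_seq st s v" using 3(7) by simp
  let ?r = "root st s"
  obtain b A p q where c: "cand st s (concl t1) = Some (b, ?r, A)"
    and d: "dec b A = (Branch, [p, q])" and h: "(b, ?r, A) \<in> set (hist st)"
    and s1: "\<And>st'. extends st st' \<Longrightarrow> (fst p, ?r, snd p) \<in> set (hist st') \<Longrightarrow> sat_seq st' (concl t1) ?r"
    and s2: "\<And>st'. extends st st' \<Longrightarrow> (fst q, ?r, snd q) \<in> set (hist st') \<Longrightarrow> sat_seq st' (concl t2) ?r"
    by (rule branch_rule[OF rule sat]) (rule that)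
  have d': "snd (dec b A) = p # q # []" using d by simp
  show ?case
  proof (cases "(b, ?r, A) \<in> set (cur st)")
    case True
    let ?st = "\<lambda>p. replace st (b, ?r, A) [p]"
    have i: "invar (?st p)" "invar (?st q)"
      using invar_replace_branch[OF 3(6) True d] by auto
    have h: "(fst p, ?r, snd p) \<in> set (hist (?st p))" for p
      by (auto simp: replace_def place_def Let_def split: prod.splits)
    have "adequate (?st p) (qty t1) (lproof (?st p) t1)"
      "adequate (?st q) (qty t2) (lproof (?st q) t2)"
      by (rule 3(1)[OF c refl refl d' refl True t(1) i(1) s1[OF extends_steps(1) h]],
          rule 3(2)[OF c refl refl d' refl True t(2) i(2) s2[OF extends_steps(1) h]])
    then show ?thesis
      using adequate_Node[OF 3(6), of "[?st p, ?st q]" "[qty t1, qty t2]"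
          "[lproof (?st p) t1, lproof (?st q) t2]"]
        G3Kt_replace_branch[OF True d] weight_replace[OF True] c d True ts
      by (simp add: seq_def)
  next
    case False
    then have dc: "decomposed st (b, ?r, A)" using h 3(6) by (auto simp: invar_def)
    show ?thesis
    proof (cases "(fst p, ?r, snd p) \<in> set (hist st)")
      case True
      have "adequate st (qty t1) (lproof st t1)"
        by (rule 3(3)[OF c refl refl d' refl False True t(1) 3(6) s1[OF extends_refl True]])
      then show ?thesis using c d False True by (simp add: adequate_mono)
    next
      case p: False
      \<comment> \<open>The consumed formula left one of its two parts in the history, so if it was
        not the first it was the second.\<close>
      then have q: "(fst q, ?r, snd q) \<in> set (hist st)"
        using dc d by (auto simp: decomposed_def place_def split: prod.splits)
      have "adequate st (qty t2) (lproof st t2)"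
        by (rule 3(4)[OF c refl refl d' refl False p t(2) 3(6) s2[OF extends_refl q]])
      then show ?thesis using c d False p by (simp add: adequate_mono)
    qed
  qed
qed

section \<open>The initial state\<close>

definition extend :: "bool \<Rightarrow> label \<Rightarrow> state \<Rightarrow> state" where
  "extend d v st =
     State (Suc (first (labs st)) # labs st) (arrow d v (Suc (first (labs st))) # rlist st) (hist st) (cur st)"

text \<open>Labels are taken in the same order as in \<open>tr1\<close> and \<open>tr2\<close>, so
  that the start sequent is the translation itself and not a renaming of it. The new edge is given
  as seen from \<open>w\<close>, hence the flag \<open>\<not> b\<close>.\<close>

primrec load :: "dstr \<Rightarrow> bool \<Rightarrow> label \<Rightarrow> state \<Rightarrow> state" where
  "load (Fml A) b w st = copy st w [(b, A)]"
| "load Unit b w st = st"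
| "load (Star X) b w st = load X (\<not> b) w st"
| "load (Bullet X) b w st = load X b (Suc (first (labs st))) (extend (\<not> b) w st)"
| "load (X \<odot> Y) b w st = load Y b w (load X b w st)"

primrec init :: "label \<Rightarrow> dseq \<Rightarrow> state" where
  "init w (X \<turnstile> Y) = load Y False w (load X True w (State [w] [] [] []))"

lemma invar_extend:
  assumes inv: "invar st" and v: "v \<in> set (labs st)"
  shows "invar (extend d v st)"
proof -
  let ?u = "Suc (first (labs st))"
  have m: "\<forall>v\<in>set (labs st). v \<le> first (labs st)"
    and T: "is_tree (set (labs st)) (set (rlist st))"
    using inv by (auto simp: invar_def)
  have "?u \<notin> set (labs st)" using m by force
  then have "is_tree (insert ?u (set (labs st))) (insert (arrow d v ?u) (set (rlist st)))"
    by (intro is_tree_add_leaf[OF T v]) (auto simp: arrow_def)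
  moreover have "extends st (extend d v st)" by (auto simp: extends_def extend_def)
  then have "\<forall>c\<in>set (hist st). c \<in> set (cur st) \<or> decomposed (extend d v st) c"
    using inv decomposed_mono unfolding invar_def by blast
  ultimately show ?thesis
    using inv m by (auto simp: invar_def extend_def le_Suc_eq)
qed

text \<open>Measures everything stored, the history included. It governs the running time, as
  \<open>weight\<close> governs the length of the sequents.\<close>

definition volume :: "state \<Rightarrow> nat" where
  "volume st = length (labs st) + length (rlist st) + length (hist st) + length (cur st)"

lemma extends_trans: "extends st st' \<Longrightarrow> extends st' st'' \<Longrightarrow> extends st st''"
  by (auto simp: extends_def)

text \<open>The factor 2 arises because a formula enters both \<open>hist\<close> and
  \<open>cur\<close>, and a bullet adds both a label and an edge.\<close>

lemma load_sound:
  "invar st \<Longrightarrow> w \<in> set (labs st) \<Longrightarrow>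
     invar (load X b w st) \<and> extends st (load X b w st) \<and> sat (load X b w st) b X w \<and>
     weight (load X b w st) \<le> weight st + slen X \<and> volume (load X b w st) \<le> volume st + 2 * slen X"
proof (induction X arbitrary: b w st)
  case (Fml A)
  then show ?case
    by (simp add: invar_copy extends_steps) (simp add: copy_def place_def weight_def volume_def)
next
  case (Bullet X)
  let ?u = "Suc (first (labs st))" and ?st = "extend (\<not> b) w st"
  have ext: "extends st ?st" and u: "?u \<in> set (labs ?st)" "arrow (\<not> b) w ?u \<in> set (rlist ?st)"
    and s: "weight ?st = Suc (weight st)" "volume ?st = Suc (Suc (volume st))"
    by (auto simp: extends_def extend_def weight_def volume_def)
  have "arrow b ?u w = arrow (\<not> b) w ?u" by (simp add: arrow_def)
  moreover note IH = Bullet.IH[OF invar_extend[OF Bullet.prems, of "\<not> b"] u(1), of b]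
  ultimately have "arrow b ?u w \<in> set (rlist (load X b ?u ?st))" "sat (load X b ?u ?st) b X ?u"
    using u(2) by (auto simp: extends_def)
  then have "sat (load (Bullet X) b w st) b (Bullet X) w" by auto
  then show ?case using IH s extends_trans[OF ext, of "load X b ?u ?st"] by simp
next
  case (Comp X Y)
  let ?st = "load X b w st"
  have X: "invar ?st" "extends st ?st" "sat ?st b X w" "weight ?st \<le> weight st + slen X"
    "volume ?st \<le> volume st + 2 * slen X"
    using Comp.IH(1)[OF Comp.prems, of b] by auto
  then have "w \<in> set (labs ?st)" using Comp.prems by (auto simp: extends_def)
  with X Comp.IH(2)[OF X(1), of w b] show ?case
    using extends_trans[OF X(2), of "load Y b w ?st"] by (auto intro: sat_mono)
next
  case (Star X)
  show ?case using Star.IH[OF Star.prems, of "\<not> b"] by simp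
qed auto

lemma invar_start: "invar (State [w] [] [] [])"
  by (simp add: invar_def is_tree_singleton)

lemma init_sound:
  "invar (init w D) \<and> sat_seq (init w D) D w \<and> weight (init w D) \<le> dlen D \<and>
     volume (init w D) \<le> 1 + 2 * dlen D"
proof (cases D)
  case (DSeq X Y)
  let ?s = "State [w] [] [] []" let ?st = "load X True w ?s"
  have X: "invar ?st" "extends ?s ?st" "sat ?st True X w" "weight ?st \<le> slen X"
      "volume ?st \<le> 1 + 2 * slen X"
    using load_sound[OF invar_start, where X = X and w = w and b = True] by (auto simp: weight_def volume_def)
  then have "w \<in> set (labs ?st)" by (auto simp: extends_def)
  from load_sound[OF X(1) this, where X = Y and b = False] X DSeq show ?thesis by (auto intro: sat_mono)
qed

section \<open>Agreement of the initial state with the translation\<close>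

lemma compose_assoc: "(\<Lambda>\<^sub>1 \<otimes> \<Lambda>\<^sub>2) \<otimes> \<Lambda>\<^sub>3 = \<Lambda>\<^sub>1 \<otimes> (\<Lambda>\<^sub>2 \<otimes> \<Lambda>\<^sub>3)"
  by (auto simp: compose_def)

lemma seq_extend: "seq (extend d v st) = seq st \<otimes> LSeq {|arrow d v (Suc (first (labs st)))|} {#} {#}"
  by (simp add: seq_def out_def extend_def compose_def)

lemma seq_copy:
  "seq (copy st w [(b, A)]) =
     seq st \<otimes> LSeq {||} (if b then {#(w, A)#} else {#}) (if b then {#} else {#(w, A)#})"
  by (simp add: seq_eq signed_seq_def copy_def compose_def place_def)

lemma labs_copy [simp]: "labs (copy st u ps) = labs st"
  by (simp add: copy_def)

definition tr :: "bool \<Rightarrow> label \<Rightarrow> label \<Rightarrow> dstr \<Rightarrow> lseq \<times> label" where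
  "tr b = (if b then tr1 else tr2)"

text \<open>The counter of the translation is always the successor of the first label of the state.
  This is the invariant that keeps the two in step.\<close>

lemma seq_load:
  "labs st \<noteq> [] \<Longrightarrow> tr b w (Suc (first (labs st))) X = (\<Lambda>, n) \<Longrightarrow>
     seq (load X b w st) = seq st \<otimes> \<Lambda> \<and> n = Suc (first (labs (load X b w st))) \<and>
     labs (load X b w st) \<noteq> []"
proof (induction X arbitrary: b w st \<Lambda> n)
  case (Fml A)
  then show ?case by (cases b) (auto simp: tr_def seq_copy)
next
  case Unit
  then show ?case by (auto simp: tr_def compose_def split: if_splits)
next
  case (Star X)
  then show ?case by (auto simp: tr_def split: if_splits)
next
  case (Bullet X)
  let ?u = "Suc (first (labs st))" and ?st = "extend (\<not> b) w st"
  obtain \<Lambda>' where L: "tr b ?u (Suc ?u) X = (\<Lambda>', n)" "\<Lambda> = LSeq {|arrow (\<not> b) w ?u|} {#} {#} \<otimes> \<Lambda>'"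
    using Bullet.prems(2) by (auto simp: tr_def split: if_splits prod.splits)
  have "labs ?st \<noteq> []" "first (labs ?st) = ?u" by (simp_all add: extend_def)
  then show ?case
    using Bullet.IH[of ?st b ?u \<Lambda>' n] L by (simp add: seq_extend compose_assoc)
next
  case (Comp X Y)
  obtain \<Lambda>\<^sub>1 n' where X: "tr b w (Suc (first (labs st))) X = (\<Lambda>\<^sub>1, n')" by fastforce
  obtain \<Lambda>\<^sub>2 n'' where Y: "tr b w n' Y = (\<Lambda>\<^sub>2, n'')" by fastforce
  have "\<Lambda> = \<Lambda>\<^sub>1 \<otimes> \<Lambda>\<^sub>2" "n = n''"
    using Comp.prems(2) X Y by (auto simp: tr_def split: if_splits)
  then show ?case
    using Comp.IH(1)[OF Comp.prems(1) X] Comp.IH(2)[of "load X b w st" b w \<Lambda>\<^sub>2 n''] Y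
    by (simp add: compose_assoc)
qed

lemma seq_init: "seq (init w D) = translate w D"
proof (cases D)
  case (DSeq X Y)
  let ?s = "State [w] [] [] []" let ?st = "load X True w ?s"
  obtain \<Lambda>\<^sub>1 n where X: "tr1 w (Suc w) X = (\<Lambda>\<^sub>1, n)" by fastforce
  obtain \<Lambda>\<^sub>2 n' where Y: "tr2 w n Y = (\<Lambda>\<^sub>2, n')" by fastforce
  have 1: "seq ?st = seq ?s \<otimes> \<Lambda>\<^sub>1" "n = Suc (first (labs ?st))" "labs ?st \<noteq> []"
    using seq_load[of ?s True w X] X by (auto simp: tr_def)
  then have "seq (load Y False w ?st) = seq ?st \<otimes> \<Lambda>\<^sub>2"
    using seq_load[of ?st False w Y] Y by (auto simp: tr_def)
  moreover have "seq ?s \<otimes> \<Lambda>\<^sub>1 = \<Lambda>\<^sub>1"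
    by (simp add: seq_def out_def flt_def compose_def)
  ultimately show ?thesis using DSeq X Y 1 by simp
qed

section \<open>The quadratic size bound\<close>

definition transform :: "label \<Rightarrow> dseq ptree \<Rightarrow> lseq ptree" where
  "transform w \<Pi> = lproof (init w (concl \<Pi>)) \<Pi>"

lemma finite_set_ptree: "finite (set_ptree \<Pi>)"
  by (induction \<Pi>) auto

lemma concl_in_set_ptree: "concl \<Pi> \<in> set_ptree \<Pi>"
  by (cases \<Pi>) simp

lemma len_le_wdth: "x \<in> set_ptree \<Pi> \<Longrightarrow> len x \<le> wdth len \<Pi>"
  by (simp add: wdth_def finite_set_ptree)

lemma wdth_le: "(\<And>x. x \<in> set_ptree \<Pi> \<Longrightarrow> len x \<le> n) \<Longrightarrow> wdth len \<Pi> \<le> n"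
  using concl_in_set_ptree[of \<Pi>] finite_set_ptree[of \<Pi>]
  unfolding wdth_def by (subst Max_le_iff) auto

lemma slen_pos: "0 < slen X"
  by (induction X) auto

lemma transform_correct:
  assumes "is_proof DKt \<Pi>" "no_cut \<Pi>"
  shows "is_proof G3Kt (transform w \<Pi>)" "concl (transform w \<Pi>) = translate w (concl \<Pi>)"
    "polytree_proof (transform w \<Pi>)"
    "psize llen (transform w \<Pi>) \<le> 2 * (psize dlen \<Pi>)\<^sup>2"
proof -
  let ?st = "init w (concl \<Pi>)" and ?P = "transform w \<Pi>"
  have "adequate ?st (qty \<Pi>) ?P"
    unfolding transform_def using init_sound[of w "concl \<Pi>"] cutfree_proofD[of \<Pi>] assms
    by (intro adequate_build) auto
  then have P: "is_proof G3Kt ?P" "concl ?P = seq ?st" "qty ?P \<le> qty \<Pi>"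
    and seqs: "\<And>\<Lambda>. \<Lambda> \<in> set_ptree ?P \<Longrightarrow> polytree_seq \<Lambda> \<and> llen \<Lambda> \<le> weight ?st + qty \<Pi>"
    by (auto simp: adequate_def)
  show "is_proof G3Kt ?P" "concl ?P = translate w (concl \<Pi>)" "polytree_proof ?P"
    using P seqs by (auto simp: seq_init polytree_proof_def)
  let ?q = "qty \<Pi>" and ?d = "wdth dlen \<Pi>"
  have d: "dlen (concl \<Pi>) \<le> ?d" by (intro len_le_wdth concl_in_set_ptree)
  have "0 < dlen (concl \<Pi>)" using slen_pos by (cases "concl \<Pi>") simp
  then have pos: "1 \<le> ?d" "1 \<le> ?q" using d qty_pos[of \<Pi>] by linarith+
  have "llen \<Lambda> \<le> ?d + ?q" if "\<Lambda> \<in> set_ptree ?P" for \<Lambda>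
    using seqs[OF that] init_sound[of w "concl \<Pi>"] d by linarith
  then have "wdth llen ?P \<le> ?d + ?q"
    by (intro wdth_le)
  \<comment> \<open>As both numbers are at least 1, their sum is at most twice their product. The
    constant 2 of the final bound comes from here.\<close>
  also have "\<dots> \<le> ?d * ?q + ?d * ?q" using pos by (intro add_mono) auto
  finally have "psize llen ?P \<le> ?q * (2 * (?d * ?q))"
    unfolding psize_def using P(3) by (intro mult_mono) auto
  also have "\<dots> \<le> (?q * ?d) * (2 * (?d * ?q))" using pos by (intro mult_right_mono) auto
  finally show "psize llen ?P \<le> 2 * (psize dlen \<Pi>)\<^sup>2"
    by (simp add: psize_def power2_eq_square mult_ac)
qed

section \<open>Running times by weakest preconditions\<close>

lemma ex_eval_Cond:
  assumes "\<exists>u s. eval P \<rho> c u s \<and>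
    (if u = Nl then \<exists>v t. eval P \<rho> b v t \<and> Q v (s + t + 1)
     else \<exists>v t. eval P \<rho> a v t \<and> Q v (s + t + 1))"
  shows "\<exists>v t. eval P \<rho> (Cond c a b) v t \<and> Q v t"
  using assms by (metis eval_evals.CondF eval_evals.CondT)

definition run :: "program \<Rightarrow> nat \<Rightarrow> val list \<Rightarrow> (val \<Rightarrow> nat \<Rightarrow> bool) \<Rightarrow> bool" where
  "run P i us Q \<longleftrightarrow> i < length P \<and> (\<exists>v t. eval P us (P ! i) v t \<and> Q v t)"

text \<open>Turns the search for an \<open>eval\<close> derivation into rewriting, with the time
  accumulated in the postcondition. Calls stay opaque as \<open>run\<close>, so that
  \<open>run_computes\<close> can plug in an induction hypothesis or an earlier result.\<close>

fun wp :: "program \<Rightarrow> expr \<Rightarrow> val list \<Rightarrow> (val \<Rightarrow> nat \<Rightarrow> bool) \<Rightarrow> bool"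
  and wps :: "program \<Rightarrow> expr list \<Rightarrow> val list \<Rightarrow> (val list \<Rightarrow> nat \<Rightarrow> bool) \<Rightarrow> bool" where
  "wp P (Var i) \<rho> Q \<longleftrightarrow> i < length \<rho> \<and> Q (\<rho> ! i) 1"
| "wp P Null \<rho> Q \<longleftrightarrow> Q Nl 1"
| "wp P (Pair a b) \<rho> Q \<longleftrightarrow> wp P a \<rho> (\<lambda>u s. wp P b \<rho> (\<lambda>v t. Q (Pr u v) (s + t + 1)))"
| "wp P (Hd a) \<rho> Q \<longleftrightarrow> wp P a \<rho> (\<lambda>u s. Q (hdv u) (s + 1))"
| "wp P (Tl a) \<rho> Q \<longleftrightarrow> wp P a \<rho> (\<lambda>u s. Q (tlv u) (s + 1))"
| "wp P (Equal a b) \<rho> Q \<longleftrightarrow>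
     wp P a \<rho> (\<lambda>u s. wp P b \<rho> (\<lambda>v t. Q (if u = v then Pr Nl Nl else Nl) (s + t + 1)))"
| "wp P (Cond c a b) \<rho> Q \<longleftrightarrow>
     wp P c \<rho> (\<lambda>u s. if u = Nl then wp P b \<rho> (\<lambda>v t. Q v (s + t + 1))
                     else wp P a \<rho> (\<lambda>v t. Q v (s + t + 1)))"
| "wp P (LetIn a b) \<rho> Q \<longleftrightarrow> wp P a \<rho> (\<lambda>u s. wp P b (u # \<rho>) (\<lambda>v t. Q v (s + t + 1)))"
| "wp P (Call i es) \<rho> Q \<longleftrightarrow> wps P es \<rho> (\<lambda>us s. run P i us (\<lambda>v t. Q v (s + t + 1)))"
| "wps P [] \<rho> Q \<longleftrightarrow> Q [] 0"
| "wps P (e # es) \<rho> Q \<longleftrightarrow> wp P e \<rho> (\<lambda>v s. wps P es \<rho> (\<lambda>vs t. Q (v # vs) (s + t)))"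

lemma wp_sound:
  "wp P e \<rho> Q \<Longrightarrow> \<exists>v t. eval P \<rho> e v t \<and> Q v t"
  "wps P es \<rho> R \<Longrightarrow> \<exists>vs t. evals P \<rho> es vs t \<and> R vs t"
proof (induction P e \<rho> Q and P es \<rho> R rule: wp_wps.induct)
  case (7 P c a b \<rho> Q)
  show ?case
    by (rule ex_eval_Cond) (use 7 in \<open>fastforce split: if_splits\<close>)
next
  case (3 P a b \<rho> Q)
  then show ?case by simp (metis eval_evals.Pair Suc_eq_plus1)
next
  case (6 P a b \<rho> Q)
  then show ?case by simp (metis eval_evals.Equal Suc_eq_plus1)
next
  case (8 P a b \<rho> Q)
  then show ?case by simp (metis eval_evals.LetIn Suc_eq_plus1)
next
  case (9 P i es \<rho> Q)
  then show ?case by (simp add: run_def) (metis eval_evals.Call Suc_eq_plus1)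
next
  case (11 P e es \<rho> Q)
  then show ?case by simp (metis eval_evals.Cons)
qed (simp, blast intro: eval_evals.intros[unfolded One_nat_def add_Suc_right add_0_right])+

definition computes :: "program \<Rightarrow> nat \<Rightarrow> val list \<Rightarrow> val \<Rightarrow> nat \<Rightarrow> bool" where
  "computes P i us v T \<longleftrightarrow> run P i us (\<lambda>v' t. v' = v \<and> t \<le> T)"

lemma computesI:
  "i < length P \<Longrightarrow> wp P (P ! i) us (\<lambda>v' t. v' = v \<and> t \<le> T) \<Longrightarrow> computes P i us v T"
  unfolding computes_def run_def using wp_sound(1) by blast

lemma run_computes: "computes P i us v T \<Longrightarrow> (\<And>t. t \<le> T \<Longrightarrow> Q v t) \<Longrightarrow> run P i us Q"
  by (auto simp: computes_def run_def)

section \<open>The program\<close>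

primrec num :: "nat \<Rightarrow> expr" where
  "num 0 = Null"
| "num (Suc n) = Pair Null (num n)"

lemma wp_num [simp]: "wp P (num n) \<rho> Q \<longleftrightarrow> Q (enc_nat n) (2 * n + 1)"
  by (induction n arbitrary: Q) (simp_all add: algebra_simps)

abbreviation "tt \<equiv> Pair Null Null"
abbreviation "neg e \<equiv> Equal e Null"
abbreviation "has_tag e n \<equiv> Equal (Hd e) (num n)"

abbreviation (input) "f_build \<equiv> Suc 0"
abbreviation (input) "f_mem \<equiv> 2 :: nat"
abbreviation (input) "f_rem \<equiv> 3 :: nat"
abbreviation (input) "f_flt \<equiv> 4 :: nat"
abbreviation (input) "f_carriers \<equiv> 5 :: nat"
abbreviation (input) "f_nbrs \<equiv> 6 :: nat"
abbreviation (input) "f_inter \<equiv> 7 :: nat"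
abbreviation (input) "f_sset \<equiv> 8 :: nat"
abbreviation (input) "f_load \<equiv> 9 :: nat"
abbreviation (input) "f_place \<equiv> 10 :: nat"
abbreviation (input) "f_copy \<equiv> 11 :: nat"
abbreviation (input) "f_extend \<equiv> 12 :: nat"
abbreviation (input) "f_put \<equiv> 13 :: nat"
abbreviation (input) "f_dec \<equiv> 14 :: nat"
abbreviation (input) "f_princ \<equiv> 15 :: nat"
abbreviation (input) "f_cand \<equiv> 16 :: nat"
abbreviation (input) "f_out \<equiv> 17 :: nat"
abbreviation (input) "f_ustep \<equiv> 18 :: nat"
abbreviation (input) "f_targets \<equiv> 19 :: nat"

definition e_main :: expr where
  "e_main =
     Call f_build
       [Call f_load
          [Tl (Hd (Var 1)), Null, Var 0,
           Call f_load
             [Hd (Hd (Var 1)), tt, Var 0,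
              Pair (Pair (Var 0) Null) (Pair Null (Pair Null Null))]],
        Var 1]"

text \<open>Each \<open>LetIn\<close> shifts the indices by one: the state is \<open>Var 0\<close>
  at the start, \<open>Var 1\<close> once the candidate is bound and \<open>Var 2\<close> after the
  second binding. A test on an encoded option asks whether it is \<open>Some\<close>.\<close>

definition e_build :: expr where
  "e_build =
     (let leaf = \<lambda>st. Pair (Call f_out [st]) Null
      in
       Cond (Tl (Var 1))
         (LetIn (Call f_cand [Var 0, Hd (Var 1), Hd (Hd (Tl (Var 1)))])
           (Cond (Tl (Tl (Var 2)))
             (Cond (Var 0)
               (LetIn (Tl (Call f_dec [Hd (Var 0), Tl (Tl (Var 0))]))
                 (Cond (Tl (Var 0))
                   (Cond (Call f_mem [Var 1, Tl (Tl (Tl (Var 2)))])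
                     (Pair (Call f_out [Var 2])
                       (Pair
                         (Call f_build
                           [Call f_put [Var 2, Var 1, Hd (Tl (Var 1)), Pair (Hd (Var 0)) Null],
                            Hd (Tl (Var 3))])
                         (Pair
                           (Call f_build
                             [Call f_put [Var 2, Var 1, Hd (Tl (Var 1)), Pair (Hd (Tl (Var 0))) Null],
                              Hd (Tl (Tl (Var 3)))])
                           Null)))
                     (Cond
                       (Call f_mem
                         [Pair (Hd (Hd (Var 0))) (Pair (Hd (Tl (Var 1))) (Tl (Hd (Var 0)))),
                          Hd (Tl (Tl (Var 2)))])
                       (Call f_build [Var 2, Hd (Tl (Var 3))])
                       (Call f_build [Var 2, Hd (Tl (Tl (Var 3)))])))
                   (leaf (Var 2))))
               (leaf (Var 1)))
             (LetIn
               (Cond (Var 0) (Call f_ustep [Var 1, Var 0, Hd (Hd (Tl (Var 2)))]) Null)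
               (Cond (Var 0)
                 (Pair (Call f_out [Var 2])
                   (Pair (Call f_build [Var 0, Hd (Tl (Var 3))]) Null))
                 (Call f_build [Var 2, Hd (Tl (Var 3))])))))
         (leaf (Var 0)))"

definition e_mem :: expr where
  "e_mem =
     Cond (Var 1)
       (Cond (Equal (Var 0) (Hd (Var 1))) tt (Call f_mem [Var 0, Tl (Var 1)]))
       Null"

definition e_rem :: expr where
  "e_rem =
     Cond (Var 1)
       (Cond (Equal (Var 0) (Hd (Var 1))) (Tl (Var 1))
         (Pair (Hd (Var 1)) (Call f_rem [Var 0, Tl (Var 1)])))
       Null"

definition e_flt :: expr where
  "e_flt =
     Cond (Var 1)
       (Cond (Equal (Var 0) (Hd (Hd (Var 1))))
         (Pair (Tl (Hd (Var 1))) (Call f_flt [Var 0, Tl (Var 1)]))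
         (Call f_flt [Var 0, Tl (Var 1)]))
       Null"

definition e_carriers :: expr where
  "e_carriers =
     Cond (Var 2)
       (Cond (Equal (Hd (Var 2)) (Pair (Var 0) (Pair (Hd (Tl (Hd (Var 2)))) (Var 1))))
         (Pair (Hd (Tl (Hd (Var 2)))) (Call f_carriers [Var 0, Var 1, Tl (Var 2)]))
         (Call f_carriers [Var 0, Var 1, Tl (Var 2)]))
       Null"

definition e_nbrs :: expr where
  "e_nbrs =
     Cond (Var 2)
       (Cond (Call f_mem [Cond (Var 0) (Hd (Hd (Var 2))) (Tl (Hd (Var 2))), Var 1])
         (Pair (Cond (Var 0) (Tl (Hd (Var 2))) (Hd (Hd (Var 2))))
           (Call f_nbrs [Var 0, Var 1, Tl (Var 2)]))
         (Call f_nbrs [Var 0, Var 1, Tl (Var 2)]))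
       Null"

definition e_inter :: expr where
  "e_inter =
     Cond (Var 0)
       (Cond (Call f_mem [Hd (Var 0), Var 1])
         (Pair (Hd (Var 0)) (Call f_inter [Tl (Var 0), Var 1]))
         (Call f_inter [Tl (Var 0), Var 1]))
       Null"

definition e_sset :: expr where
  "e_sset =
     Cond (has_tag (Var 2) 0) (Call f_carriers [Var 1, Tl (Var 2), Hd (Tl (Tl (Var 0)))])
       (Cond (has_tag (Var 2) 1) (Hd (Var 0))
         (Cond (has_tag (Var 2) 2) (Call f_sset [Var 0, neg (Var 1), Tl (Var 2)])
           (Cond (has_tag (Var 2) 3)
             (Call f_nbrs [Var 1, Call f_sset [Var 0, Var 1, Tl (Var 2)], Hd (Tl (Var 0))])
             (Call f_inter
               [Call f_sset [Var 0, Var 1, Hd (Tl (Var 2))],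
                Call f_sset [Var 0, Var 1, Tl (Tl (Var 2))]]))))"

definition e_load :: expr where
  "e_load =
     Cond (has_tag (Var 0) 0)
       (Call f_copy [Var 3, Var 2, Pair (Pair (Var 1) (Tl (Var 0))) Null])
       (Cond (has_tag (Var 0) 1) (Var 3)
         (Cond (has_tag (Var 0) 2) (Call f_load [Tl (Var 0), neg (Var 1), Var 2, Var 3])
           (Cond (has_tag (Var 0) 3)
             (Call f_load
               [Tl (Var 0), Var 1, Pair Null (Hd (Hd (Var 3))),
                Call f_extend [neg (Var 1), Var 2, Var 3]])
             (Call f_load
               [Tl (Tl (Var 0)), Var 1, Var 2,
                Call f_load [Hd (Tl (Var 0)), Var 1, Var 2, Var 3]]))))"

definition e_place :: expr where
  "e_place =
     Cond (Var 1)
       (Pair (Pair (Hd (Hd (Var 1))) (Pair (Var 0) (Tl (Hd (Var 1)))))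
         (Call f_place [Var 0, Tl (Var 1), Var 2]))
       (Var 2)"

definition e_copy :: expr where
  "e_copy =
     Pair (Hd (Var 0))
       (Pair (Hd (Tl (Var 0)))
         (Pair (Call f_place [Var 1, Var 2, Hd (Tl (Tl (Var 0)))])
           (Call f_place [Var 1, Var 2, Tl (Tl (Tl (Var 0)))])))"

definition e_extend :: expr where
  "e_extend =
     LetIn (Pair Null (Hd (Hd (Var 2))))
       (Pair (Pair (Var 0) (Hd (Var 3)))
         (Pair
           (Pair (Cond (Var 1) (Pair (Var 2) (Var 0)) (Pair (Var 0) (Var 2))) (Hd (Tl (Var 3))))
           (Tl (Tl (Var 3)))))"

definition e_put :: expr where
  "e_put =
     Pair (Hd (Var 0))
       (Pair (Hd (Tl (Var 0)))
         (Pair (Call f_place [Var 2, Var 3, Hd (Tl (Tl (Var 0)))])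
           (Call f_place [Var 2, Var 3, Call f_rem [Var 1, Tl (Tl (Tl (Var 0)))]])))"

definition e_dec :: expr where
  "e_dec =
     (let one = \<lambda>p. Pair (Pair p (Tl (Var 1))) Null;
          two = \<lambda>p. Pair (Pair p (Hd (Tl (Var 1)))) (Pair (Pair (Var 0) (Tl (Tl (Var 1)))) Null);
          modal = \<lambda>f d. Pair (Pair tt (Pair f d)) (one (Var 0))
      in
       Cond (has_tag (Var 1) 3) (Pair tt (one (neg (Var 0))))
         (Cond (has_tag (Var 1) 4) (Pair (neg (Var 0)) (two (Var 0)))
           (Cond (has_tag (Var 1) 5) (Pair (Var 0) (two (Var 0)))
             (Cond (has_tag (Var 1) 6) (Pair (neg (Var 0)) (two (neg (Var 0))))
               (Cond (has_tag (Var 1) 7) (modal (neg (Var 0)) tt)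
                 (Cond (has_tag (Var 1) 8) (modal (Var 0) tt)
                   (Cond (has_tag (Var 1) 9) (modal (neg (Var 0)) Null)
                     (Cond (has_tag (Var 1) 10) (modal (Var 0) Null)
                       (Pair Null Null)))))))))"

definition e_princ :: expr where
  "e_princ =
     Cond (has_tag (Tl (Var 0)) 0)
       (Cond (has_tag (Hd (Var 0)) 0)
         (Cond (Equal (Tl (Var 1)) (Tl (Var 0))) (Pair tt (Tl (Hd (Var 0))))
           (Cond (Equal (Tl (Var 1)) (Pair (num 3) (Tl (Var 0)))) (Pair tt (Tl (Hd (Var 0))))
             (Cond
               (Equal (Tl (Var 1)) (Pair (num 2) (Pair (num 3) (Pair (num 2) (Tl (Var 0))))))
               (Pair tt (Tl (Hd (Var 0))))
               (Pair Null (Tl (Tl (Var 0)))))))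
         (Pair Null (Tl (Tl (Var 0)))))
       (Cond (has_tag (Hd (Var 0)) 0) (Pair tt (Tl (Hd (Var 0)))) Null)"

definition e_cand :: expr where
  "e_cand =
     LetIn (Call f_princ [Var 1, Var 2])
       (Cond (Var 0)
         (Pair (Hd (Var 0))
           (Pair
             (Hd (Call f_inter
               [Call f_sset [Var 1, tt, Hd (Var 2)], Call f_sset [Var 1, Null, Tl (Var 2)]]))
             (Tl (Var 0))))
         Null)"

definition e_out :: expr where
  "e_out =
     Pair (Hd (Tl (Var 0)))
       (Pair (Call f_flt [tt, Tl (Tl (Tl (Var 0)))]) (Call f_flt [Null, Tl (Tl (Tl (Var 0)))]))"

definition e_ustep :: expr where
  "e_ustep =
     Cond (Call f_mem [Var 1, Tl (Tl (Tl (Var 0)))])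
       (LetIn (Call f_dec [Hd (Var 1), Tl (Tl (Var 1))])
         (Cond (Hd (Var 0))
           (Cond (Hd (Hd (Var 0)))
             (Cond (Hd (Tl (Hd (Var 0))))
               (Call f_put
                 [Call f_extend [Tl (Tl (Hd (Var 0))), Hd (Tl (Var 2)), Var 1], Var 2,
                  Pair Null (Hd (Hd (Var 1))), Tl (Var 0)])
               (LetIn
                 (Call f_targets
                   [Var 1, Tl (Tl (Hd (Var 0))), Hd (Var 2), Hd (Tl (Var 2)), Var 3])
                 (Cond (Var 0) (Call f_copy [Var 2, Hd (Var 0), Tl (Var 1)]) Null)))
             (Call f_put [Var 1, Var 2, Hd (Tl (Var 2)), Tl (Var 0)]))
           Null))
       Null"

definition e_targets :: expr where
  "e_targets =
     Call f_inter
       [Call f_nbrs [Var 1, Pair (Var 3) Null, Hd (Tl (Var 0))],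
        Cond (Var 2) (Call f_sset [Var 0, Null, Tl (Var 4)])
          (Call f_sset [Var 0, tt, Hd (Var 4)])]"

definition prog :: program where
  "prog =
     [e_main, e_build, e_mem, e_rem, e_flt, e_carriers, e_nbrs, e_inter, e_sset, e_load,
      e_place, e_copy, e_extend, e_put, e_dec, e_princ, e_cand, e_out, e_ustep,
      e_targets]"

lemma length_prog [simp]: "length prog = 20"
  by (simp add: prog_def)

lemma prog_nth [simp]:
  "prog ! 0 = e_main" "prog ! f_build = e_build" "prog ! f_mem = e_mem" "prog ! f_rem = e_rem"
  "prog ! f_flt = e_flt" "prog ! f_carriers = e_carriers" "prog ! f_nbrs = e_nbrs"
  "prog ! f_inter = e_inter" "prog ! f_sset = e_sset" "prog ! f_load = e_load"
  "prog ! f_place = e_place" "prog ! f_copy = e_copy" "prog ! f_extend = e_extend"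
  "prog ! f_put = e_put" "prog ! f_dec = e_dec" "prog ! f_princ = e_princ"
  "prog ! f_cand = e_cand" "prog ! f_out = e_out" "prog ! f_ustep = e_ustep"
  "prog ! f_targets = e_targets"
  by (simp_all add: prog_def)

section \<open>Encodings\<close>

definition enc_bool :: "bool \<Rightarrow> val" where
  "enc_bool b = (if b then Pr Nl Nl else Nl)"

lemma enc_bool_simps [simp]:
  "enc_bool True = Pr Nl Nl" "enc_bool False = Nl" "enc_bool b = Nl \<longleftrightarrow> \<not> b"
  "enc_bool b = enc_bool c \<longleftrightarrow> b = c"
  by (auto simp: enc_bool_def)

abbreviation enc_sform :: "sform \<Rightarrow> val" where
  "enc_sform \<equiv> enc_pair enc_bool (enc_pair enc_nat enc_form)"

abbreviation enc_part :: "bool \<times> form \<Rightarrow> val" where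
  "enc_part \<equiv> enc_pair enc_bool enc_form"

abbreviation enc_edge :: "label \<times> label \<Rightarrow> val" where
  "enc_edge \<equiv> enc_pair enc_nat enc_nat"

primrec enc_state :: "state \<Rightarrow> val" where
  "enc_state (State L R H G) =
     Pr (enc_list enc_nat L)
       (Pr (enc_list enc_edge R) (Pr (enc_list enc_sform H) (enc_list enc_sform G)))"

lemma enc_state_sel [simp]:
  "hdv (enc_state st) = enc_list enc_nat (labs st)"
  "hdv (tlv (enc_state st)) = enc_list enc_edge (rlist st)"
  "hdv (tlv (tlv (enc_state st))) = enc_list enc_sform (hist st)"
  "tlv (tlv (tlv (enc_state st))) = enc_list enc_sform (cur st)"
  "enc_state st \<noteq> Nl"
  by (cases st; simp)+

text \<open>Laid out for the tests in \<open>e_ustep\<close>: the code is \<open>Nl\<close> only for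
  \<open>Branch\<close>, and its head differs from \<open>Nl\<close> only for
  \<open>Modal\<close>.\<close>

primrec enc_kind :: "kind \<Rightarrow> val" where
  "enc_kind Branch = Nl"
| "enc_kind Alpha = Pr Nl Nl"
| "enc_kind (Modal f d) = Pr (Pr Nl Nl) (Pr (enc_bool f) (enc_bool d))"

text \<open>\<open>Some\<close> needs no tag, as the values concerned are all encoded as pairs and
  \<open>Nl\<close> is free for \<open>None\<close>.\<close>

primrec enc_option :: "('a \<Rightarrow> val) \<Rightarrow> 'a option \<Rightarrow> val" where
  "enc_option e None = Nl"
| "enc_option e (Some x) = e x"

lemma enc_nat_inject [simp]: "enc_nat m = enc_nat n \<longleftrightarrow> m = n"
proof (induction m arbitrary: n)
  case 0 then show ?case by (cases n) auto
next
  case (Suc m) then show ?case by (cases n) auto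
qed

lemma enc_nat_numeral [simp]: "enc_nat (numeral k) = Pr Nl (enc_nat (pred_numeral k))"
  by (simp add: numeral_eq_Suc)

lemma enc_form_inject [simp]: "enc_form A = enc_form B \<longleftrightarrow> A = B"
proof (induction A arbitrary: B)
  case (Atom p) then show ?case by (cases B) (auto simp flip: enc_nat_inject)
qed (case_tac B; auto)+

lemma enc_dstr_inject [simp]: "enc_dstr X = enc_dstr Y \<longleftrightarrow> X = Y"
  by (induction X arbitrary: Y; case_tac Y; auto)

lemma enc_pair_inject:
  assumes "\<And>x y. e x = e y \<longleftrightarrow> x = y" "\<And>x y. e' x = e' y \<longleftrightarrow> x = y"
  shows "enc_pair e e' p = enc_pair e e' q \<longleftrightarrow> p = q"
  using assms by (cases p; cases q) simp

lemma enc_inject [simp]: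
  "enc_sform x = enc_sform y \<longleftrightarrow> x = y" "enc_edge e = enc_edge f \<longleftrightarrow> e = f"
  by (intro enc_pair_inject enc_nat_inject enc_form_inject enc_bool_simps)+

lemma enc_pair_sel [simp]:
  "hdv (enc_pair e e' x) = e (fst x)" "tlv (enc_pair e e' x) = e' (snd x)" "enc_pair e e' x \<noteq> Nl"
  by (cases x; simp)+

lemma enc_list_Nl [simp]: "enc_list e xs = Nl \<longleftrightarrow> xs = []"
  by (cases xs) auto

lemma hdv_labs [simp]: "hdv (enc_list enc_nat xs) = enc_nat (first xs)"
  by (cases xs) auto

section \<open>Correctness and running time of the auxiliary functions\<close>

text \<open>Injectivity makes the test on codes decide equality of the elements. The numerical
  factors here and below are generous; only their independence of the input matters.\<close>

lemma computes_mem: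
  assumes inj: "\<And>x y. e x = e y \<longleftrightarrow> x = y"
  shows "computes prog f_mem [e x, enc_list e xs] (enc_bool (x \<in> set xs)) (20 * (length xs + 1))"
proof (induction xs)
  case Nil
  show ?case by (rule computesI) (auto simp: e_mem_def)
next
  case (Cons y xs)
  show ?case by (rule computesI) (auto simp: e_mem_def inj intro!: run_computes[OF Cons.IH])
qed

lemmas computes_mem_label = computes_mem[of enc_nat, OF enc_nat_inject]
lemmas computes_mem_sform = computes_mem[of enc_sform, OF enc_inject(1)]

lemma computes_rem:
  "computes prog f_rem [enc_sform c, enc_list enc_sform xs] (enc_list enc_sform (remove1 c xs))
     (20 * (length xs + 1))"
proof (induction xs)
  case Nil
  show ?case by (rule computesI) (auto simp: e_rem_def)
next
  case (Cons y xs)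
  show ?case by (rule computesI) (auto simp: e_rem_def intro!: run_computes[OF Cons.IH])
qed

lemma flt_Cons [simp]: "flt b (x # xs) = (if fst x = b then snd x # flt b xs else flt b xs)"
  by (simp add: flt_def)

lemma computes_flt:
  "computes prog f_flt [enc_bool b, enc_list enc_sform xs]
     (enc_list (enc_pair enc_nat enc_form) (flt b xs)) (20 * (length xs + 1))"
proof (induction xs)
  case Nil
  show ?case by (rule computesI) (auto simp: e_flt_def flt_def)
next
  case (Cons y xs)
  obtain c x where y: "y = (c, x)" by (cases y)
  show ?case
  proof (cases "c = b")
    case True
    show ?thesis
      unfolding y True
      by (rule computesI, simp, simp add: e_flt_def del: enc_bool_simps(1,2),
          rule run_computes[OF Cons.IH], simp)
  next
    case False
    then have "b \<noteq> c" by simp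
    note ne = this False
    show ?thesis
      unfolding y
      by (rule computesI, simp, simp add: e_flt_def ne del: enc_bool_simps(1,2),
          rule run_computes[OF Cons.IH], simp)
  qed
qed

lemma computes_carriers:
  "computes prog f_carriers [enc_bool b, enc_form A, enc_list enc_sform xs]
     (enc_list enc_nat (carriers b A xs)) (30 * (length xs + 1))"
proof (induction xs)
  case Nil
  show ?case by (rule computesI) (auto simp: e_carriers_def carriers_def)
next
  case (Cons y xs)
  obtain b' v B where y: "y = (b', v, B)" by (cases y)
  show ?case
    by (rule computesI)
      (auto simp: e_carriers_def carriers_def y intro!: run_computes[OF Cons.IH])
qed

lemma nbrs_Cons [simp]:
  "nbrs True S ((x, y) # R) = (if x \<in> set S then y # nbrs True S R else nbrs True S R)"
  "nbrs False S ((x, y) # R) = (if y \<in> set S then x # nbrs False S R else nbrs False S R)"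
  by (simp_all add: nbrs_def)

lemma computes_nbrs:
  "computes prog f_nbrs [enc_bool d, enc_list enc_nat S, enc_list enc_edge R]
     (enc_list enc_nat (nbrs d S R)) (60 * ((length R + 1) * (length S + 1)))"
proof (induction R)
  case Nil
  show ?case by (rule computesI) (auto simp: e_nbrs_def nbrs_def)
next
  case (Cons e R)
  obtain x y where e: "e = (x, y)" by (cases e)
  note mem = computes_mem_label[of x S] computes_mem_label[of y S]
  show ?case
  proof (cases d)
    case True
    then have d: "d = True" by simp
    note IH = Cons.IH[unfolded d enc_bool_simps(1)]
    show ?thesis
      unfolding d
      by (rule computesI)
        (auto simp: e_nbrs_def e algebra_simps intro!: run_computes[OF IH] run_computes[OF mem(1)])
  next
    case False
    then have d: "d = False" by simp
    note IH = Cons.IH[unfolded d enc_bool_simps(2)]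
    show ?thesis
      unfolding d
      by (rule computesI)
        (auto simp: e_nbrs_def e algebra_simps intro!: run_computes[OF IH] run_computes[OF mem(2)])
  qed
qed

lemma computes_inter:
  "computes prog f_inter [enc_list enc_nat xs, enc_list enc_nat ys]
     (enc_list enc_nat (inter xs ys)) (60 * ((length xs + 1) * (length ys + 1)))"
proof (induction xs)
  case Nil
  show ?case by (rule computesI) (auto simp: e_inter_def inter_def)
next
  case (Cons x xs)
  show ?case
    by (rule computesI)
      (auto simp: e_inter_def inter_def algebra_simps
        intro!: run_computes[OF Cons.IH] run_computes[OF computes_mem_label])
qed

lemma computes_place:
  "computes prog f_place [enc_nat u, enc_list enc_part ps, enc_list enc_sform xs]
     (enc_list enc_sform (place u ps @ xs)) (30 * (length ps + 1))"
proof (induction ps)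
  case Nil
  show ?case by (rule computesI) (auto simp: e_place_def place_def)
next
  case (Cons p ps)
  obtain b A where p: "p = (b, A)" by (cases p)
  show ?case
    by (rule computesI)
      (auto simp: e_place_def place_def p intro!: run_computes[OF Cons.IH])
qed

section \<open>Cost of computing the satisfying labels\<close>

lemma enc_bool_if:
  "(if b then Pr Nl Nl else Nl) = enc_bool b" "(if b then Nl else Pr Nl Nl) = enc_bool (\<not> b)"
  by (simp_all add: enc_bool_def)

lemma length_carriers: "length (carriers b A H) \<le> length H"
  by (simp add: carriers_def)

lemma length_nbrs: "length (nbrs d S R) \<le> length R"
  by (simp add: nbrs_def)

lemma length_inter: "length (inter xs ys) \<le> length xs"
  by (simp add: inter_def)

text \<open>A bullet keeps at most one label per edge and \<open>inter\<close> only filters its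
  first list, so nesting causes no growth even though repetitions are not removed.\<close>

lemma length_sset: "length (sset st b X) \<le> volume st"
proof (induction X arbitrary: b)
  case (Fml A)
  show ?case using length_carriers[of b A "hist st"] by (simp add: volume_def)
next
  case (Bullet X)
  show ?case using length_nbrs[of b "sset st b X" "rlist st"] by (simp add: volume_def)
next
  case (Comp X Y)
  show ?case using length_inter[of "sset st b X" "sset st b Y"] Comp.IH(1)[of b] by simp
qed (simp_all add: volume_def)

text \<open>\<open>nbrs\<close> and \<open>inter\<close> make a membership test inside a loop, which
  costs a product of two list lengths. The added ones cover empty lists.\<close>

definition area :: "state \<Rightarrow> nat" where
  "area st = (volume st + 1) * (volume st + 1)"

lemma area_bounds:
  "volume st + 1 \<le> area st" "1 \<le> area st"
  "m \<le> volume st \<Longrightarrow> n \<le> volume st \<Longrightarrow> (m + 1) * (n + 1) \<le> area st"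
proof -
  show "m \<le> volume st \<Longrightarrow> n \<le> volume st \<Longrightarrow> (m + 1) * (n + 1) \<le> area st"
    unfolding area_def by (intro mult_le_mono add_mono order_refl)
qed (simp_all add: area_def)

lemma computes_sset:
  "computes prog f_sset [enc_state st, enc_bool b, enc_dstr X] (enc_list enc_nat (sset st b X))
     (200 * slen X * area st)"
proof (induction X arbitrary: b)
  case (Fml A)
  have "length (hist st) + 1 \<le> area st" using area_bounds(1)[of st] by (simp add: volume_def)
  then show ?case
    by (intro computesI; simp add: e_sset_def; intro run_computes[OF computes_carriers])
      (use area_bounds(2)[of st] in simp)
next
  case Unit
  show ?case by (rule computesI) (use area_bounds(2)[of st] in \<open>simp_all add: e_sset_def\<close>)
next
  case (Star X)
  show ?case
    by (rule computesI, simp, simp add: e_sset_def enc_bool_if,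
        rule run_computes[OF Star.IH[of "\<not> b"]])
      (use area_bounds(2)[of st] in \<open>simp add: algebra_simps\<close>)
next
  case (Bullet X)
  have m: "(length (rlist st) + 1) * (length (sset st b X) + 1) \<le> area st"
    by (rule area_bounds(3)) (simp_all add: length_sset, simp add: volume_def)
  show ?case
    by (rule computesI, simp, simp add: e_sset_def enc_bool_if,
        rule run_computes[OF Bullet.IH[of b]], rule run_computes[OF computes_nbrs])
      (use m area_bounds(2)[of st] in \<open>simp add: algebra_simps\<close>)
next
  case (Comp X Y)
  have m: "(length (sset st b X) + 1) * (length (sset st b Y) + 1) \<le> area st"
    by (intro area_bounds(3) length_sset)
  show ?case
    by (rule computesI, simp, simp add: e_sset_def enc_bool_if,
        rule run_computes[OF Comp.IH(1)[of b]], rule run_computes[OF Comp.IH(2)[of b]],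
        rule run_computes[OF computes_inter])
      (use m area_bounds(2)[of st] in \<open>simp add: algebra_simps\<close>)
qed

lemma computes_copy:
  "computes prog f_copy [enc_state st, enc_nat u, enc_list enc_part ps] (enc_state (copy st u ps))
     (100 * (length ps + 1))"
  by (rule computesI, simp, simp add: e_copy_def copy_def,
      rule run_computes[OF computes_place], rule run_computes[OF computes_place]) simp

lemma computes_extend:
  "computes prog f_extend [enc_bool d, enc_nat v, enc_state st] (enc_state (extend d v st)) 50"
  by (rule computesI; cases d; cases st) (simp_all add: e_extend_def extend_def)

text \<open>\<open>replace\<close> and \<open>grow\<close> differ only in where the parts go, so one
  program function with the label as an argument serves both.\<close>

definition put :: "state \<Rightarrow> sform \<Rightarrow> label \<Rightarrow> (bool \<times> form) list \<Rightarrow> state" where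
  "put st c u ps =
     State (labs st) (rlist st) (place u ps @ hist st) (place u ps @ remove1 c (cur st))"

lemma replace_eq_put: "replace st (b, v, A) ps = put st (b, v, A) v ps"
  by (simp add: replace_def put_def Let_def)

lemma grow_eq_put:
  "grow st d (b, v, A) ps = put (extend d v st) (b, v, A) (Suc (first (labs st))) ps"
  by (simp add: grow_def put_def extend_def Let_def)

lemma computes_put:
  "computes prog f_put [enc_state st, enc_sform c, enc_nat u, enc_list enc_part ps]
     (enc_state (put st c u ps)) (100 * (length ps + length (cur st) + 2))"
  by (rule computesI, simp, simp add: e_put_def put_def,
      rule run_computes[OF computes_place], rule run_computes[OF computes_rem],
      rule run_computes[OF computes_place]) simp

lemma computes_dec:
  "computes prog f_dec [enc_bool b, enc_form A]
     (Pr (enc_kind (fst (dec b A))) (enc_list enc_part (snd (dec b A)))) 300"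
  by (rule computesI; cases b; cases A) (simp_all add: e_dec_def)

text \<open>The time is constant although structures are compared, because an equality test costs
  one step whatever the size.\<close>

lemma computes_princ:
  "computes prog f_princ [enc_dseq s, enc_dseq s1] (enc_option enc_part (princ s s1)) 200"
proof -
  obtain X Y X1 Y1 where s: "s = (X \<turnstile> Y)" "s1 = (X1 \<turnstile> Y1)" by (cases s; cases s1)
  note inj = enc_dstr_inject[of Y1 "Fml B" for B, simplified]
    enc_dstr_inject[of Y1 "Bullet (Fml B)" for B, simplified]
    enc_dstr_inject[of Y1 "SBS (Fml B)" for B, simplified]
  show ?thesis
    by (rule computesI; cases X; cases Y) (simp_all add: e_princ_def princ_def s inj)
qed

lemma dlen_pos: "1 \<le> dlen s"
  using slen_pos by (cases s) (simp add: Suc_leI)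

lemma dlen_area: "1 \<le> dlen s * area st" "area st \<le> dlen s * area st"
  using dlen_pos[of s] area_bounds(2)[of st] by (auto simp: Suc_le_eq)

lemma computes_cand:
  "computes prog f_cand [enc_state st, enc_dseq s, enc_dseq s1]
     (enc_option enc_sform (cand st s s1)) (1000 * (dlen s * area st))"
proof -
  obtain X Y where s: "s = (X \<turnstile> Y)" by (cases s)
  have m: "(length (sset st True X) + 1) * (length (sset st False Y) + 1) \<le> area st"
    by (intro area_bounds(3) length_sset)
  have a: "1 \<le> slen X * area st + slen Y * area st" "area st \<le> slen X * area st + slen Y * area st"
    using dlen_area[where s = s and st = st] by (simp_all add: s algebra_simps)
  show ?thesis
  proof (cases "princ s s1")
    case None
    show ?thesis
      by (rule computesI, simp, simp add: e_cand_def, rule run_computes[OF computes_princ])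
        (use a in \<open>simp add: None[unfolded s] cand_def s algebra_simps\<close>)
  next
    case (Some p)
    obtain b A where p: "p = (b, A)" by (cases p)
    show ?thesis
      by (rule computesI, simp, simp add: e_cand_def, rule run_computes[OF computes_princ],
          simp add: s Some[unfolded s] p,
          rule run_computes[OF computes_sset[of st True, unfolded enc_bool_simps]],
          rule run_computes[OF computes_sset[of st False, unfolded enc_bool_simps]],
          rule run_computes[OF computes_inter])
        (use m a in \<open>simp add: cand_def Some[unfolded s] p root_def s algebra_simps\<close>)
  qed
qed

lemma computes_out:
  "computes prog f_out [enc_state st] (enc_lseq_lists (out st)) (100 * (length (cur st) + 1))"
  by (rule computesI, simp, simp add: e_out_def,
      rule run_computes[OF computes_flt[of True, unfolded enc_bool_simps]],
      rule run_computes[OF computes_flt[of False, unfolded enc_bool_simps]])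
    (simp add: enc_lseq_lists_def out_def)

lemma computes_targets:
  "computes prog f_targets [enc_state st, enc_bool d, enc_bool b, enc_nat v, enc_dseq s1]
     (enc_list enc_nat (targets st d b v s1)) (500 * (dlen s1 * area st))"
proof -
  obtain X Y where s1: "s1 = (X \<turnstile> Y)" by (cases s1)
  let ?N = "nbrs d [v] (rlist st)" and ?S = "sset st (\<not> b) (side (\<not> b) s1)"
  have a: "1 \<le> slen X * area st + slen Y * area st" "area st \<le> slen X * area st + slen Y * area st"
    using dlen_area[where s = s1 and st = st] by (simp_all add: s1 algebra_simps)
  have R: "length (rlist st) + 1 \<le> area st"
    using area_bounds(1)[of st] by (simp add: volume_def)
  have m: "(length ?N + 1) * (length ?S + 1) \<le> area st"
    using length_nbrs[of d "[v]" "rlist st"]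
    by (intro area_bounds(3) length_sset) (simp add: volume_def)
  note nbrs = computes_nbrs[of d "[v]" "rlist st", simplified]
  show ?thesis
  proof (cases b)
    case True
    show ?thesis
      by (rule computesI, simp, simp add: e_targets_def True s1, rule run_computes[OF nbrs],
          rule run_computes[OF computes_sset[of st False, unfolded enc_bool_simps]],
          rule run_computes[OF computes_inter])
        (use m R a in \<open>simp add: True s1 targets_def algebra_simps\<close>)
  next
    case False
    then have b: "b = False" by simp
    show ?thesis
      by (rule computesI, simp, simp add: e_targets_def b s1, rule run_computes[OF nbrs],
          rule run_computes[OF computes_sset[of st True, unfolded enc_bool_simps]],
          rule run_computes[OF computes_inter])
        (use m R a in \<open>simp add: b s1 targets_def algebra_simps\<close>)
  qed
qed

lemma computes_ustep:
  "computes prog f_ustep [enc_state st, enc_sform c, enc_dseq s1]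
     (enc_option enc_state (ustep st c s1)) (2000 * (dlen s1 * area st))"
proof -
  obtain b v A where c: "c = (b, v, A)" by (cases c)
  obtain k ps where d: "dec b A = (k, ps)" by (cases "dec b A")
  have ps: "length ps \<le> 2" using length_dec[of b A] d by simp
  define n where "n = dlen s1 * area st"
  have "length (cur st) + 1 \<le> area st" using area_bounds(1)[of st] by (simp add: volume_def)
  then have cur: "length (cur st) + 1 \<le> n"
    using dlen_area(2)[of st s1] unfolding n_def by linarith
  note targets = computes_targets[of st _ _ _ s1, folded n_def]
  note mem = computes_mem_sform[of c "cur st", unfolded c, simplified]
  note dec = computes_dec[of b A, unfolded d fst_conv snd_conv]
  note start = c e_ustep_def d ustep_def
  show ?thesis
    unfolding n_def[symmetric]
  proof (cases "c \<in> set (cur st)")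
    case False
    then have not_cur: "(b, v, A) \<notin> set (cur st)" by (simp add: c)
    show "computes prog f_ustep [enc_state st, enc_sform c, enc_dseq s1]
     (enc_option enc_state (ustep st c s1)) (2000 * n)"
      by (rule computesI, simp, simp add: start not_cur, rule run_computes[OF mem])
        (use not_cur cur in simp)
  next
    case True
    then have in_cur: "(b, v, A) \<in> set (cur st)" by (simp add: c)
    show "computes prog f_ustep [enc_state st, enc_sform c, enc_dseq s1]
     (enc_option enc_state (ustep st c s1)) (2000 * n)"
    proof (cases k)
      case Branch
      show "computes prog f_ustep [enc_state st, enc_sform c, enc_dseq s1]
     (enc_option enc_state (ustep st c s1)) (2000 * n)"
        by (rule computesI, simp, simp add: start Branch in_cur, rule run_computes[OF mem],
            simp add: in_cur, rule run_computes[OF dec])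
          (use cur in \<open>simp add: Branch\<close>)
    next
      case Alpha
      show "computes prog f_ustep [enc_state st, enc_sform c, enc_dseq s1]
     (enc_option enc_state (ustep st c s1)) (2000 * n)"
        by (rule computesI, simp, simp add: start Alpha in_cur replace_eq_put,
            rule run_computes[OF mem], simp add: in_cur, rule run_computes[OF dec],
            simp add: Alpha, rule run_computes[OF computes_put[where c = "(b, v, A)", simplified]])
          (use cur ps in simp)
    next
      case (Modal f e)
      show "computes prog f_ustep [enc_state st, enc_sform c, enc_dseq s1]
     (enc_option enc_state (ustep st c s1)) (2000 * n)"
      proof (cases f)
        case True
        show "computes prog f_ustep [enc_state st, enc_sform c, enc_dseq s1]
     (enc_option enc_state (ustep st c s1)) (2000 * n)"
          by (rule computesI, simp, simp add: start Modal True in_cur grow_eq_put,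
              rule run_computes[OF mem], simp add: in_cur, rule run_computes[OF dec],
              simp add: Modal True, rule run_computes[OF computes_extend],
              rule run_computes[OF computes_put[where c = "(b, v, A)" and u = "Suc n" for n, simplified]])
            (use cur ps in \<open>simp add: extend_def\<close>)
      next
        case False
        then have f: "f = False" by simp
        note steps = run_computes[OF mem] run_computes[OF dec] run_computes[OF targets]
        show "computes prog f_ustep [enc_state st, enc_sform c, enc_dseq s1]
     (enc_option enc_state (ustep st c s1)) (2000 * n)"
        proof (cases "targets st e b v s1")
          case Nil
          show "computes prog f_ustep [enc_state st, enc_sform c, enc_dseq s1]
     (enc_option enc_state (ustep st c s1)) (2000 * n)"
            by (rule computesI, simp, simp add: start Modal f in_cur Nil,
                rule steps(1), simp add: in_cur, rule steps(2), simp add: Modal f, rule steps(3))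
              (use cur in \<open>simp add: Nil\<close>)
        next
          case (Cons u us)
          show "computes prog f_ustep [enc_state st, enc_sform c, enc_dseq s1]
     (enc_option enc_state (ustep st c s1)) (2000 * n)"
            by (rule computesI, simp, simp add: start Modal f in_cur Cons,
                rule steps(1), simp add: in_cur, rule steps(2), simp add: Modal f, rule steps(3),
                simp add: Cons, rule run_computes[OF computes_copy])
              (use cur ps in simp)
        qed
      qed
    qed
  qed
qed

section \<open>Growth of the state and total running time\<close>

lemma volume_put:
  "c \<in> set (cur st) \<Longrightarrow> volume (put st c u ps) < volume st + 2 * length ps"
  by (cases "cur st") (auto simp: volume_def put_def place_def length_remove1 dest: length_pos_if_in_set)

text \<open>The 3 is attained by \<open>Alpha\<close>: two parts enter two lists each and one
  formula leaves \<open>cur\<close>. A fresh label also costs at most 3, from a label, an edge, one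
  part entered twice and one formula removed; copying costs 2.\<close>

lemma volume_ustep:
  assumes "ustep st c s1 = Some st'"
  shows "volume st' \<le> volume st + 3"
proof -
  obtain b v A where c: "c = (b, v, A)" by (cases c)
  from assms[unfolded c] show ?thesis
  proof (cases rule: ustep_Some)
    case (alpha ps)
    then show ?thesis
      using volume_put[OF alpha(1), of v ps] length_dec[of b A] by (simp add: replace_eq_put)
  next
    case (fresh d ps)
    let ?st = "extend d v st"
    have "(b, v, A) \<in> set (cur ?st)" "volume ?st = volume st + 2"
      using fresh(1) by (simp_all add: extend_def volume_def)
    then show ?thesis
      using volume_put[of "(b, v, A)" ?st "Suc (first (labs st))" ps] length_dec_Modal[of b A] fresh by (simp add: grow_eq_put)
  next
    case (copy d ps u)
    then show ?thesis using length_dec_Modal[of b A False d] by (simp add: copy_def volume_def place_def)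
  qed
qed

lemma enc_ptree_sel [simp]:
  "hdv (enc_ptree e t) = e (concl t)"
  "tlv (enc_ptree e t) = enc_list (enc_ptree e) (subproofs t)"
proof -
  have "enc_list (\<lambda>v. v) (map f xs) = enc_list f xs" for f :: "'a ptree \<Rightarrow> val" and xs
    by (induction xs) auto
  then show "tlv (enc_ptree e t) = enc_list (enc_ptree e) (subproofs t)" by (cases t) simp
qed (cases t; simp)

lemma area_mono: "volume st \<le> m \<Longrightarrow> area st \<le> (m + 1) * (m + 1)"
  unfolding area_def by (intro mult_le_mono) auto

lemma set_ptree_concl: "\<forall>s\<in>set_ptree (Node s ts). P s \<Longrightarrow> t \<in> set ts \<Longrightarrow>
    P s \<and> P (concl t) \<and> (\<forall>s\<in>set_ptree t. P s)"
  using concl_in_set_ptree[of t] by auto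

text \<open>\<open>m\<close> is a budget for the volume, fixed throughout the recursion: a node adds
  at most 3 to the volume and takes at least 3 off the remaining demand. So every node is charged
  the same amount.\<close>

lemma computes_build:
  assumes "volume st + 3 * qty \<Pi> \<le> m" "\<forall>s\<in>set_ptree \<Pi>. dlen s \<le> d"
  shows "computes prog f_build [enc_state st, enc_ptree enc_dseq \<Pi>]
    (enc_ptree enc_lseq_lists (build st \<Pi>)) (qty \<Pi> * (5000 * (d * ((m + 1) * (m + 1)))))"
  using assms
proof (induction st \<Pi> rule: build.induct)
  case (1 st s)
  let ?k = "d * ((m + 1) * (m + 1))"
  have "1 \<le> d" using dlen_pos[of s] 1(2) by simp
  then have "1 * (m + 1) * 1 \<le> ?k" by (simp only: mult.assoc) (intro mult_le_mono; simp)
  moreover have "length (cur st) \<le> m" using 1(1) by (simp add: volume_def)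
  ultimately have b: "length (cur st) + 1 \<le> ?k" by simp
  show ?case
    by (rule computesI, simp, simp add: e_build_def Let_def del: enc_ptree.simps,
        simp, rule run_computes[OF computes_out])
      (use b in simp)
next
  case (2 st s t)
  let ?k = "d * ((m + 1) * (m + 1))"
  have s: "dlen s \<le> d" and t: "dlen (concl t) \<le> d" "\<forall>s\<in>set_ptree t. dlen s \<le> d"
    using set_ptree_concl[OF 2(4), of t] by auto
  have vol: "volume st + 3 * qty t + 3 \<le> m" using 2(3) by simp
  have area: "area st \<le> (m + 1) * (m + 1)" using vol by (intro area_mono) simp
  have b1: "dlen s * area st \<le> ?k" and b2: "dlen (concl t) * area st \<le> ?k"
    using s t(1) area by (intro mult_le_mono; simp)+
  have "length (cur st) \<le> volume st" by (simp add: volume_def)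
  then have b3: "1 \<le> ?k" "length (cur st) + 1 \<le> ?k"
    using b1 dlen_area[where s = s and st = st] area_bounds(1)[of st] by linarith+
  \<comment> \<open>Hiding the product behind \<open>k\<close> leaves comparisons that are linear in
    \<open>k\<close> and \<open>qty t * k\<close>.\<close>
  define k where "k = ?k"
  note bounds = b1[folded k_def] b2[folded k_def] b3[folded k_def]
  let ?o = "Option.bind (cand st s (concl t)) (\<lambda>c. ustep st c (concl t))"
  show ?case
    unfolding k_def[symmetric]
  proof (cases ?o)
    case None
    note IH = 2(1)[OF None _ t(2), folded k_def]
    have IH': "computes prog f_build [enc_state st, enc_ptree enc_dseq t]
        (enc_ptree enc_lseq_lists (build st t)) (qty t * (5000 * k))"
      using IH vol by simp
    show "computes prog f_build [enc_state st, enc_ptree enc_dseq (Node s [t])]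
        (enc_ptree enc_lseq_lists (build st (Node s [t]))) (qty (Node s [t]) * (5000 * k))"
    proof (cases "cand st s (concl t)")
      case None
      show ?thesis
        by (rule computesI, simp, simp add: e_build_def Let_def, rule run_computes[OF computes_cand],
            simp add: None, rule run_computes[OF IH'])
          (use bounds in \<open>simp add: None algebra_simps\<close>)
    next
      case (Some c)
      then have u: "ustep st c (concl t) = None" using \<open>?o = None\<close> by simp
      show ?thesis
        by (rule computesI, simp, simp add: e_build_def Let_def, rule run_computes[OF computes_cand],
            simp add: Some, rule run_computes[OF computes_ustep], simp add: u, rule run_computes[OF IH'])
          (use bounds in \<open>simp add: Some u algebra_simps\<close>)
    qed
  next
    case (Some st')
    then obtain c where c: "cand st s (concl t) = Some c" and u: "ustep st c (concl t) = Some st'"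
      by (auto split: bind_splits)
    have IH: "computes prog f_build [enc_state st', enc_ptree enc_dseq t]
        (enc_ptree enc_lseq_lists (build st' t)) (qty t * (5000 * k))"
      using 2(2)[OF Some _ t(2), folded k_def] vol volume_ustep[OF u] by simp
    show "computes prog f_build [enc_state st, enc_ptree enc_dseq (Node s [t])]
        (enc_ptree enc_lseq_lists (build st (Node s [t]))) (qty (Node s [t]) * (5000 * k))"
      by (rule computesI, simp, simp add: e_build_def Let_def, rule run_computes[OF computes_cand],
          simp add: c, rule run_computes[OF computes_ustep], simp add: u,
          rule run_computes[OF computes_out], rule run_computes[OF IH])
        (use bounds in \<open>simp add: c u algebra_simps\<close>)
  qed
next
  case (3 st s t1 t2 ts)
  let ?k = "d * ((m + 1) * (m + 1))" and ?t = "Node s (t1 # t2 # ts)"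
  have s: "dlen s \<le> d" and t1: "\<forall>s\<in>set_ptree t1. dlen s \<le> d" and t2: "\<forall>s\<in>set_ptree t2. dlen s \<le> d"
    using 3(6) by auto
  have vol: "volume st + 3 * qty t1 + 3 \<le> m" "volume st + 3 * qty t2 + 3 \<le> m" using 3(5) by simp_all
  have area: "area st \<le> (m + 1) * (m + 1)" using vol by (intro area_mono) simp
  have b1: "dlen s * area st \<le> ?k"
    using s area by (intro mult_le_mono)
  have "length (cur st) \<le> volume st" "length (hist st) \<le> volume st" by (simp_all add: volume_def)
  then have b3: "1 \<le> ?k" "length (cur st) + 1 \<le> ?k" "length (hist st) + 1 \<le> ?k"
    using b1 dlen_area[where s = s and st = st] area_bounds(1)[of st] by linarith+
  define k where "k = ?k"
  note bounds = b1[folded k_def] b3[folded k_def]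
  have goal: "computes prog f_build [enc_state st, enc_ptree enc_dseq ?t]
      (enc_ptree enc_lseq_lists (build st ?t)) (qty ?t * (5000 * k))"
  proof (cases "cand st s (concl t1)")
    case None
    show ?thesis
      by (rule computesI, simp, simp add: e_build_def Let_def, rule run_computes[OF computes_cand],
          simp add: None, rule run_computes[OF computes_out])
        (use bounds in \<open>simp add: None algebra_simps\<close>)
  next
    case (Some c)
    obtain b v A where c: "c = (b, v, A)" by (cases c)
    have cand: "cand st s (concl t1) = Some (b, v, A)" using Some c by simp
    note steps = run_computes[OF computes_cand] run_computes[OF computes_dec[of b A]]
      run_computes[OF computes_out]
    show ?thesis
    proof (cases "\<exists>p q ps. snd (dec b A) = p # q # ps")
      case False
      then have "snd (dec b A) = [] \<or> (\<exists>p. snd (dec b A) = [p])"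
        by (metis list.exhaust)
      then show ?thesis
      proof
        assume d: "snd (dec b A) = []"
        show ?thesis
          by (rule computesI, simp, simp add: e_build_def Let_def, rule steps(1),
              simp add: cand, rule steps(2), simp add: d, rule steps(3))
            (use bounds in \<open>simp add: cand d algebra_simps\<close>)
      next
        assume "\<exists>p. snd (dec b A) = [p]"
        then obtain p where d: "snd (dec b A) = [p]" ..
        show ?thesis
          by (rule computesI, simp, simp add: e_build_def Let_def, rule steps(1),
              simp add: cand, rule steps(2), simp add: d, rule steps(3))
            (use bounds in \<open>simp add: cand d algebra_simps\<close>)
      qed
    next
      case True
      then obtain p q ps where d: "snd (dec b A) = p # q # ps" by blast
      note IH = 3(1-4)[OF cand refl refl d refl, folded k_def]
      note mem = run_computes[OF computes_mem_sform[of "(b, v, A)" "cur st", simplified]]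
        run_computes[OF computes_mem_sform[of "(fst p, v, snd p)" "hist st", simplified]]
      show ?thesis
      proof (cases "(b, v, A) \<in> set (cur st)")
        case in_cur: True
        have put: "volume (put st (b, v, A) v [x]) \<le> volume st + 3" for x
          using volume_put[OF in_cur, of v "[x]"] by simp
        have IH1: "computes prog f_build [enc_state (put st (b, v, A) v [p]), enc_ptree enc_dseq t1]
            (enc_ptree enc_lseq_lists (build (put st (b, v, A) v [p]) t1)) (qty t1 * (5000 * k))"
          using IH(1)[OF in_cur _ t1] put[of p] vol by (simp add: replace_eq_put)
        have IH2: "computes prog f_build [enc_state (put st (b, v, A) v [q]), enc_ptree enc_dseq t2]
            (enc_ptree enc_lseq_lists (build (put st (b, v, A) v [q]) t2)) (qty t2 * (5000 * k))"
          using IH(2)[OF in_cur _ t2] put[of q] vol by (simp add: replace_eq_put)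
        note put_run = run_computes[OF computes_put[of st "(b, v, A)" v "[x]" for x, simplified]]
        show ?thesis
          by (rule computesI, simp, simp add: e_build_def Let_def, rule steps(1),
              simp add: cand, rule steps(2), simp add: d in_cur, rule mem(1), simp add: in_cur,
              rule steps(3), rule put_run, rule run_computes[OF IH1],
              rule put_run, rule run_computes[OF IH2])
            (use bounds in \<open>simp add: cand d in_cur replace_eq_put algebra_simps\<close>)
      next
        case not_cur: False
        show ?thesis
        proof (cases "(fst p, v, snd p) \<in> set (hist st)")
          case True
          have IH': "computes prog f_build [enc_state st, enc_ptree enc_dseq t1]
              (enc_ptree enc_lseq_lists (build st t1)) (qty t1 * (5000 * k))"
            using IH(3)[OF not_cur True _ t1] vol by simp
          show ?thesis
            by (rule computesI, simp, simp add: e_build_def Let_def, rule steps(1),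
                simp add: cand, rule steps(2), simp add: d not_cur True, rule mem(1), simp add: not_cur,
                rule mem(2), simp add: True, rule run_computes[OF IH'])
              (use bounds in \<open>simp add: cand d not_cur True algebra_simps\<close>)
        next
          case False
          have IH': "computes prog f_build [enc_state st, enc_ptree enc_dseq t2]
              (enc_ptree enc_lseq_lists (build st t2)) (qty t2 * (5000 * k))"
            using IH(4)[OF not_cur False _ t2] vol by simp
          show ?thesis
            by (rule computesI, simp, simp add: e_build_def Let_def, rule steps(1),
                simp add: cand, rule steps(2), simp add: d not_cur False, rule mem(1), simp add: not_cur,
                rule mem(2), simp add: False, rule run_computes[OF IH'])
              (use bounds in \<open>simp add: cand d not_cur False algebra_simps\<close>)
        qed
      qed
    qed
  qed
  then show ?case unfolding k_def .
qed

lemma computes_load: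
  "computes prog f_load [enc_dstr X, enc_bool b, enc_nat w, enc_state st]
     (enc_state (load X b w st)) (500 * slen X)"
proof (induction X arbitrary: b w st)
  case (Fml A)
  show ?case
    by (rule computesI, simp, simp add: e_load_def,
        rule run_computes[OF computes_copy[where ps = "[(b, A)]", simplified]]) simp
next
  case Unit
  show ?case by (rule computesI) (simp_all add: e_load_def)
next
  case (Star X)
  show ?case
    by (rule computesI, simp, simp add: e_load_def enc_bool_if,
        rule run_computes[OF Star.IH[of "\<not> b"]]) simp
next
  case (Bullet X)
  show ?case
    by (rule computesI, simp, simp add: e_load_def enc_bool_if,
        rule run_computes[OF computes_extend],
        rule run_computes[OF Bullet.IH[of b "Suc n" for n, simplified]]) simp
next
  case (Comp X Y)
  show ?case
    by (rule computesI, simp, simp add: e_load_def,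
        rule run_computes[OF Comp.IH(1)], rule run_computes[OF Comp.IH(2)]) simp
qed

lemma runs_transform:
  assumes "volume (init w (concl \<Pi>)) + 3 * qty \<Pi> \<le> m" "\<forall>s\<in>set_ptree \<Pi>. dlen s \<le> d"
  shows "\<exists>t. runs prog [enc_nat w, enc_ptree enc_dseq \<Pi>]
      (enc_ptree enc_lseq_lists (build (init w (concl \<Pi>)) \<Pi>)) t \<and>
    t \<le> 500 * d + 50 + qty \<Pi> * (5000 * (d * ((m + 1) * (m + 1))))"
proof -
  obtain X Y where D: "concl \<Pi> = (X \<turnstile> Y)" by (cases "concl \<Pi>")
  have d: "slen X + slen Y \<le> d" using assms(2) concl_in_set_ptree[of \<Pi>] D by fastforce
  note build = computes_build[OF assms, unfolded D init.simps]
  have "computes prog 0 [enc_nat w, enc_ptree enc_dseq \<Pi>]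
      (enc_ptree enc_lseq_lists (build (init w (concl \<Pi>)) \<Pi>))
      (500 * d + 50 + qty \<Pi> * (5000 * (d * ((m + 1) * (m + 1)))))"
    by (rule computesI, simp, simp add: e_main_def D,
        rule run_computes[OF computes_load[of X True w "State [w] [] [] []", simplified]],
        rule run_computes[OF computes_load[of Y False, simplified]],
        rule run_computes[OF build])
      (use d in \<open>simp add: algebra_simps\<close>)
  then show ?thesis by (auto simp: computes_def run_def runs_def prog_def)
qed

lemma polytime_transform: "polytime_proof_map transform"
proof -
  \<comment> \<open>With \<open>n\<close> the size of the display proof, \<open>500 * n + 50\<close>
    pays for loading. The traversal costs \<open>n\<close> nodes times
    \<open>5000 * n * (5 * n + 2) * (5 * n + 2)\<close>, where the budget is
    \<open>m = 1 + 5 * n\<close>: at most \<open>1 + 2 * n\<close> for the initial volume and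
    \<open>3 * n\<close> for its growth.\<close>
  define p :: "nat poly" where
    "p = [:50, 500:] + [:0, 5000:] * [:0, 1:] * [:2, 5:] * [:2, 5:]"
  have "\<exists>v t. runs prog [enc_nat w, enc_ptree enc_dseq \<Pi>] v t \<and> represents v (transform w \<Pi>) \<and>
      t \<le> poly p (psize dlen \<Pi>)" for w \<Pi>
  proof -
    let ?q = "qty \<Pi>" and ?d = "wdth dlen \<Pi>" and ?n = "psize dlen \<Pi>"
    have all: "\<forall>s\<in>set_ptree \<Pi>. dlen s \<le> ?d" by (simp add: len_le_wdth)
    have "1 \<le> ?q" using qty_pos[of \<Pi>] by linarith
    moreover have "1 \<le> ?d" using all concl_in_set_ptree[of \<Pi>] dlen_pos[of "concl \<Pi>"] by force
    ultimately have qn: "?q \<le> ?n" and dn: "?d \<le> ?n" by (simp_all add: psize_def)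
    have "volume (init w (concl \<Pi>)) \<le> 1 + 2 * ?d"
      using init_sound[of w "concl \<Pi>"] all concl_in_set_ptree[of \<Pi>] by fastforce
    then have "volume (init w (concl \<Pi>)) + 3 * ?q \<le> 1 + 5 * ?n" using qn dn by linarith
    from runs_transform[OF this all] obtain t where
      t: "runs prog [enc_nat w, enc_ptree enc_dseq \<Pi>]
          (enc_ptree enc_lseq_lists (build (init w (concl \<Pi>)) \<Pi>)) t"
      and le: "t \<le> 500 * ?d + 50 + ?q * (5000 * (?d * ((1 + 5 * ?n + 1) * (1 + 5 * ?n + 1))))"
      by blast
    note le
    also have "\<dots> \<le> 500 * ?n + 50 + ?n * (5000 * (?n * ((1 + 5 * ?n + 1) * (1 + 5 * ?n + 1))))"
      using qn dn by (intro add_mono mult_le_mono order_refl)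
    also have "\<dots> = poly p ?n" by (simp add: p_def algebra_simps)
    finally show ?thesis using t unfolding transform_def represents_def by blast
  qed
  then show ?thesis
    unfolding polytime_proof_map_def polytime_computable_on_def by (auto split: prod.splits) blast
qed

theorem theorem7:
  shows "\<exists>f :: label \<Rightarrow> dseq ptree \<Rightarrow> lseq ptree.
    polytime_proof_map f \<and>
    (\<exists>C :: nat. \<forall>(w :: label) (\<Pi> :: dseq ptree) (D :: dseq).
       is_proof DKt \<Pi> \<and> no_cut \<Pi> \<and> concl \<Pi> = D \<longrightarrow>
         is_proof G3Kt (f w \<Pi>) \<and> concl (f w \<Pi>) = translate w D \<and>
         polytree_proof (f w \<Pi>) \<and>
         psize llen (f w \<Pi>) \<le> C * (psize dlen \<Pi>)\<^sup>2)"
proof (intro exI conjI allI impI)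
  show "polytime_proof_map transform" by (rule polytime_transform)
next
  fix w \<Pi> D
  assume "is_proof DKt \<Pi> \<and> no_cut \<Pi> \<and> concl \<Pi> = D"
  then have \<Pi>: "is_proof DKt \<Pi>" "no_cut \<Pi>" and D: "concl \<Pi> = D" by auto
  note correct = transform_correct[OF \<Pi>, of w]
  show "is_proof G3Kt (transform w \<Pi>)" by (rule correct(1))
  show "concl (transform w \<Pi>) = translate w D" using correct(2) D by simp
  show "polytree_proof (transform w \<Pi>)" by (rule correct(3))
  show "psize llen (transform w \<Pi>) \<le> 2 * (psize dlen \<Pi>)\<^sup>2" by (rule correct(4))
qed

end
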